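(* There is a compact connected Hausdorff space $L$ of topological weight $\mathfrak{c}$ and a normal measure $\mu\in P(L)$ such that $L$ is the support of $\mu$.
   Context: All compact spaces are Hausdorff. For a compact space $K$, $P(K)$ denotes the set of all regular Borel probability measures on $K$. A measure $\mu\in P(K)$ is normal if it is order-continuous as a functional on the Banach lattice $C(K)$ of continuous real-valued functions on $K$; equivalently, $\mu(F)=0$ whenever $F\subseteq K$ is a closed set with empty interior. A space $K$ is the support of $\mu\in P(K)$ if $\mu(U)>0$ for every non-empty open set $U\subseteq K$. The weight of a topological space is the minimal cardinality of a base of its topology, and $\mathfrak{c}=2^{\aleph_0}$ is the cardinality of the continuum. *)

theory Defs
  imports "HOL-Probability.Probability"
begin

definition topology_base :: "'a topology \<Rightarrow> 'a set set \<Rightarrow> bool" where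
  "topology_base X \<B> \<longleftrightarrow>
     (\<forall>V\<in>\<B>. openin X V) \<and>
     (\<forall>U x. openin X U \<and> x \<in> U \<longrightarrow> (\<exists>V\<in>\<B>. x \<in> V \<and> V \<subseteq> U))"

text \<open>The cardinal is given by a set \<open>S\<close> representing it: the weight of \<open>X\<close> is the
  cardinality of \<open>S\<close>.\<close>

definition has_weight :: "'a topology \<Rightarrow> 'b set \<Rightarrow> bool" where
  "has_weight X S \<longleftrightarrow>
     (\<exists>\<B>. topology_base X \<B> \<and> \<B> \<approx> S) \<and>
     (\<forall>\<B>. topology_base X \<B> \<longrightarrow> S \<lesssim> \<B>)"

definition borel_of :: "'a topology \<Rightarrow> 'a measure" where
  "borel_of X = sigma (topspace X) {U. openin X U}"

definition regular_measure :: "'a topology \<Rightarrow> 'a measure \<Rightarrow> bool" where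
  "regular_measure X M \<longleftrightarrow>
     (\<forall>A\<in>sets M.
        emeasure M A = (SUP C\<in>{C. compactin X C \<and> C \<subseteq> A}. emeasure M C) \<and>
        emeasure M A = (INF U\<in>{U. openin X U \<and> A \<subseteq> U}. emeasure M U))"

definition regular_borel_probs :: "'a topology \<Rightarrow> 'a measure set" where
  "regular_borel_probs X =
     {M. sets M = sets (borel_of X) \<and> prob_space M \<and> regular_measure X M}"

text \<open>\<open>C(X)\<close>, with its pointwise order, is represented by functions on the whole type that are
  continuous on \<open>topspace X\<close>; their values outside \<open>topspace X\<close> are irrelevant, so the order
  is the pointwise one on \<open>topspace X\<close> only.\<close>

definition cont_funs :: "'a topology \<Rightarrow> ('a \<Rightarrow> real) set" where
  "cont_funs X = {f. continuous_map X euclideanreal f}"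

definition cont_le :: "'a topology \<Rightarrow> ('a \<Rightarrow> real) \<Rightarrow> ('a \<Rightarrow> real) \<Rightarrow> bool" where
  "cont_le X f g \<longleftrightarrow> (\<forall>x\<in>topspace X. f x \<le> g x)"

text \<open>Suprema and infima are taken in the lattice \<open>C(X)\<close>; in general they differ from the
  pointwise ones.\<close>

definition cont_is_sup :: "'a topology \<Rightarrow> ('a \<Rightarrow> real) set \<Rightarrow> ('a \<Rightarrow> real) \<Rightarrow> bool" where
  "cont_is_sup X D f \<longleftrightarrow> f \<in> cont_funs X \<and> (\<forall>g\<in>D. cont_le X g f) \<and>
     (\<forall>h\<in>cont_funs X. (\<forall>g\<in>D. cont_le X g h) \<longrightarrow> cont_le X f h)"

definition cont_is_inf :: "'a topology \<Rightarrow> ('a \<Rightarrow> real) set \<Rightarrow> ('a \<Rightarrow> real) \<Rightarrow> bool" where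
  "cont_is_inf X D f \<longleftrightarrow> f \<in> cont_funs X \<and> (\<forall>g\<in>D. cont_le X f g) \<and>
     (\<forall>h\<in>cont_funs X. (\<forall>g\<in>D. cont_le X h g) \<longrightarrow> cont_le X h f)"

definition upward_directed :: "'a topology \<Rightarrow> ('a \<Rightarrow> real) set \<Rightarrow> bool" where
  "upward_directed X D \<longleftrightarrow> (\<forall>f\<in>D. \<forall>g\<in>D. \<exists>h\<in>D. cont_le X f h \<and> cont_le X g h)"

definition downward_directed :: "'a topology \<Rightarrow> ('a \<Rightarrow> real) set \<Rightarrow> bool" where
  "downward_directed X D \<longleftrightarrow> (\<forall>f\<in>D. \<forall>g\<in>D. \<exists>h\<in>D. cont_le X h f \<and> cont_le X h g)"

text \<open>Order-continuity of an order-preserving functional on \<open>C(X)\<close>: existing suprema of upwards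
  directed sets and infima of downwards directed sets are preserved. The functional is assumed
  to be order-preserving, as integration against a measure is, so that the real \<open>SUP\<close> and
  \<open>INF\<close> below are over bounded sets.\<close>

definition order_continuous_functional :: "'a topology \<Rightarrow> (('a \<Rightarrow> real) \<Rightarrow> real) \<Rightarrow> bool" where
  "order_continuous_functional X \<phi> \<longleftrightarrow>
     (\<forall>D f. D \<subseteq> cont_funs X \<and> D \<noteq> {} \<and> upward_directed X D \<and> cont_is_sup X D f
        \<longrightarrow> \<phi> f = (SUP g\<in>D. \<phi> g)) \<and>
     (\<forall>D f. D \<subseteq> cont_funs X \<and> D \<noteq> {} \<and> downward_directed X D \<and> cont_is_inf X D f
        \<longrightarrow> \<phi> f = (INF g\<in>D. \<phi> g))"

definition normal_measure :: "'a topology \<Rightarrow> 'a measure \<Rightarrow> bool" where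
  "normal_measure X M \<longleftrightarrow> order_continuous_functional X (\<lambda>f. integral\<^sup>L M f)"

definition is_support_of :: "'a topology \<Rightarrow> 'a measure \<Rightarrow> bool" where
  "is_support_of X M \<longleftrightarrow> (\<forall>U. openin X U \<and> U \<noteq> {} \<longrightarrow> measure M U > 0)"

end

theory Submission
  imports Defs
begin

text \<open>The space is a compactification of the real line with the density topology, in which a set
  is open when it is Lebesgue measurable and all its points are density points. This topology is
  connected (a clopen set would have an indicator function that is a derivative, contradicting the
  intermediate value property), its non-empty open sets have positive measure, and every
  measurable set of positive measure has non-empty interior. By a theorem of Lusin and Menchoff
  such an interior even contains all points where some non-zero continuous function does not
  vanish. Hence, in the compactification \<open>L\<close> generated by the density-continuous functions into \<open>[0,1]\<close> and for the image \<open>\<mu>\<close> of a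
  Gaussian measure, closed sets of positive measure have non-empty interior, which is
  normality of \<open>\<mu>\<close>. There are only continuum many such functions when they are moreover upper
  semicontinuous for the usual topology, and the integers are \<open>C\<close>-embedded, which bounds the weight
  from both sides.\<close>

section \<open>Density points\<close>

text \<open>The usual home of a normal measure with full support is the Stone space of a measure
  algebra, where every measurable set turns into a clopen one, so connectedness is lost. In the
  density topology a measurable set and its complement have disjoint open interiors that cover
  almost everything, but not everything: the null set left over holds the space together. The price
  is paid twice. Null sets are density-closed, so the topology is far from Lindelof, and uncountable
  unions are controlled only up to null sets: a finite measure is exhausted by countably many
  members of the family. Both the measurability of unions and the regularity of the image measure
  rest on this. Moreover the density topology is not normal, so Urysohn's construction cannot run
  inside it; it runs through sets that are closed in the usual topology, and this is where the
  semicontinuity comes from.\<close>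

definition density_point :: "real set \<Rightarrow> real \<Rightarrow> bool" where
  "density_point A x \<longleftrightarrow>
     (\<forall>\<epsilon>>0. \<exists>\<delta>>0. \<forall>h. 0 < h \<and> h < \<delta> \<longrightarrow> measure lebesgue ({x-h..x+h} - A) \<le> \<epsilon> * h)"

lemma interval_Diff_lmeasurable:
  fixes a b :: real
  assumes "A \<in> sets lebesgue"
  shows "{a..b} - A \<in> lmeasurable"
  using assms by (intro fmeasurable_Diff) auto

lemma density_pointE:
  assumes "density_point A x" "0 < \<epsilon>"
  obtains \<delta> where "0 < \<delta>" "\<And>h. 0 < h \<Longrightarrow> h < \<delta> \<Longrightarrow> measure lebesgue ({x-h..x+h} - A) \<le> \<epsilon> * h"
  using assms unfolding density_point_def by blast

lemma density_point_mono_ae: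
  assumes "density_point A x" "A \<in> sets lebesgue" "B \<in> sets lebesgue" "A - B \<in> null_sets lebesgue"
  shows "density_point B x"
proof -
  have "measure lebesgue ({x-h..x+h} - B) \<le> measure lebesgue ({x-h..x+h} - A)" for h
  proof -
    have "measure lebesgue ({x-h..x+h} - B) \<le> measure lebesgue (({x-h..x+h} - A) \<union> (A - B))"
      using assms by (intro measure_mono_fmeasurable fmeasurable.Un interval_Diff_lmeasurable) (auto simp: fmeasurableI_null_sets)
    also have "\<dots> = measure lebesgue ({x-h..x+h} - A)"
      using assms by (intro measure_Un_null_set) auto
    finally show ?thesis .
  qed
  then show ?thesis
    using assms(1) unfolding density_point_def by (meson order_trans)
qed

lemma density_point_mono:
  assumes "density_point A x" "A \<in> sets lebesgue" "B \<in> sets lebesgue" "A \<subseteq> B"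
  shows "density_point B x"
proof -
  have "A - B = {}"
    using assms by blast
  then show ?thesis
    using assms by (metis density_point_mono_ae null_sets.empty_sets)
qed

lemma density_point_Int:
  assumes "density_point A x" "density_point B x" "A \<in> sets lebesgue" "B \<in> sets lebesgue"
  shows "density_point (A \<inter> B) x"
  unfolding density_point_def
proof (intro allI impI)
  fix \<epsilon> :: real assume "0 < \<epsilon>"
  then obtain d1 d2 where d: "0 < d1" "0 < d2"
    "\<And>h. 0 < h \<Longrightarrow> h < d1 \<Longrightarrow> measure lebesgue ({x-h..x+h} - A) \<le> \<epsilon> / 2 * h"
    "\<And>h. 0 < h \<Longrightarrow> h < d2 \<Longrightarrow> measure lebesgue ({x-h..x+h} - B) \<le> \<epsilon> / 2 * h"
    using assms(1,2)[THEN density_pointE, of "\<epsilon> / 2"] by (metis half_gt_zero)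
  have "measure lebesgue ({x-h..x+h} - A \<inter> B) \<le> \<epsilon> * h" if "0 < h" "h < min d1 d2" for h
  proof -
    have "measure lebesgue ({x-h..x+h} - A \<inter> B) \<le> measure lebesgue ({x-h..x+h} - A) + measure lebesgue ({x-h..x+h} - B)"
      unfolding Diff_Int using assms
      by (intro measure_Un_le) auto
    with d that show ?thesis
      by (smt (verit) field_sum_of_halves distrib_right)
  qed
  then show "\<exists>\<delta>>0. \<forall>h. 0 < h \<and> h < \<delta> \<longrightarrow> measure lebesgue ({x-h..x+h} - A \<inter> B) \<le> \<epsilon> * h"
    using d by (intro exI[of _ "min d1 d2"]) auto
qed

lemma density_point_Compl:
  assumes "density_point A x" "A \<in> sets lebesgue"
  shows "\<not> density_point (- A) x"
proof
  assume "density_point (- A) x"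
  then have "density_point (A \<inter> - A) x"
    using assms by (intro density_point_Int) (auto simp: Compl_in_sets_lebesgue)
  then have "density_point {} x" by simp
  \<comment> \<open>With \<epsilon> = 1 this bounds the whole interval, of length
    \<open>2 * h\<close>, by \<open>h\<close>.\<close>
  then obtain d where d: "0 < d"
    "\<And>h. 0 < h \<Longrightarrow> h < d \<Longrightarrow> measure lebesgue ({x-h..x+h} - {}) \<le> 1 * h"
    by (metis density_pointE zero_less_one)
  then show False
    using d(2)[of "d/2"] by auto
qed

lemma density_point_open:
  assumes "open A" "x \<in> A"
  shows "density_point A x"
proof -
  obtain e where e: "0 < e" "ball x e \<subseteq> A"
    using assms openE by blast
  have "measure lebesgue ({x-h..x+h} - A) = 0" if "h < e" for h
  proof -
    have "{x-h..x+h} - A = {}"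
      using e(2) that by (auto simp: subset_iff dist_real_def)
    then show ?thesis by (metis measure_empty)
  qed
  then show ?thesis
    unfolding density_point_def using e(1) by (intro allI impI exI[of _ e]) auto
qed

section \<open>Lebesgue's density theorem\<close>

text \<open>Lebesgue differentiation over cubes with lower corner \<open>x\<close>, in dimension one
  the right-hand intervals, applied to the indicator of \<open>- A\<close>, which vanishes at the
  points of \<open>A\<close>.\<close>

lemma right_density_ae:
  assumes "A \<in> sets (lebesgue :: real measure)"
  obtains N where "negligible N"
    "\<And>x \<epsilon>. x \<in> A - N \<Longrightarrow> 0 < \<epsilon> \<Longrightarrow> \<exists>\<delta>>0. \<forall>h. 0 < h \<and> h < \<delta> \<longrightarrow> measure lebesgue ({x..x+h} - A) \<le> \<epsilon> * h"
proof -
  have int: "(indicator (- A) :: real \<Rightarrow> real) integrable_on cbox a b"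
    and val: "integral (cbox a b) (indicator (- A) :: real \<Rightarrow> real) = measure lebesgue ({a..b} - A)" for a b
  proof -
    have *: "- A \<inter> cbox a b \<in> lmeasurable"
      using interval_Diff_lmeasurable[OF assms, of a b] by (simp add: Diff_eq Int_commute)
    then show "(indicator (- A) :: real \<Rightarrow> real) integrable_on cbox a b"
      by (simp add: integrable_on_indicator Int_commute)
    show "integral (cbox a b) (indicator (- A) :: real \<Rightarrow> real) = measure lebesgue ({a..b} - A)"
      using * by (simp add: integral_indicator Diff_eq Int_commute)
  qed
  obtain N where N: "negligible N"
    "\<And>x e. \<lbrakk>x \<notin> N; 0 < e\<rbrakk> \<Longrightarrow> \<exists>d>0. \<forall>h. 0 < h \<and> h < d \<longrightarrow>
        norm (integral (cbox x (x + h *\<^sub>R One)) (indicator (- A)) /\<^sub>R h ^ DIM(real) - (indicator (- A) x :: real)) < e"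
    using integrable_ccontinuous_explicit[OF int] by blast
  show thesis
  proof (rule that[OF N(1)])
    fix x \<epsilon> assume x: "x \<in> A - N" and "0 < (\<epsilon>::real)"
    then obtain d where d: "d > 0" "\<And>h. 0 < h \<and> h < d \<longrightarrow>
        norm (integral (cbox x (x + h *\<^sub>R One)) (indicator (- A)) /\<^sub>R h ^ DIM(real) - (indicator (- A) x :: real)) < \<epsilon>"
      using N(2) by blast
    have "measure lebesgue ({x..x+h} - A) \<le> \<epsilon> * h" if "0 < h" "h < d" for h
      using d(2)[of h] that x val[of x "x+h"] by (simp add: field_simps split: if_splits)
    then show "\<exists>\<delta>>0. \<forall>h. 0 < h \<and> h < \<delta> \<longrightarrow> measure lebesgue ({x..x+h} - A) \<le> \<epsilon> * h"
      using d(1) by blast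
  qed
qed

lemma measure_lebesgue_uminus_image: "measure lebesgue (uminus ` S) = measure lebesgue (S :: real set)"
  using measure_lebesgue_affine[of "-1" 0 S] by simp

text \<open>Left-hand intervals are right-hand intervals of the reflected set, so the one-sided
  statement is used for \<open>A\<close> and for its reflection, each with half of
  \<epsilon>.\<close>

lemma lebesgue_density:
  assumes "A \<in> sets lebesgue"
  shows "{x \<in> A. \<not> density_point A x} \<in> null_sets lebesgue"
proof -
  obtain N where N: "negligible N"
    "\<And>x \<epsilon>. x \<in> A - N \<Longrightarrow> 0 < \<epsilon> \<Longrightarrow> \<exists>\<delta>>0. \<forall>h. 0 < h \<and> h < \<delta> \<longrightarrow> measure lebesgue ({x..x+h} - A) \<le> \<epsilon> * h"
    using right_density_ae[OF assms] by blast
  have "uminus ` A \<in> sets lebesgue"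
    using assms by (intro differentiable_image_in_sets_lebesgue) (auto intro!: derivative_intros simp: differentiable_on_def)
  then obtain N' where N': "negligible N'"
    "\<And>x \<epsilon>. x \<in> uminus ` A - N' \<Longrightarrow> 0 < \<epsilon> \<Longrightarrow> \<exists>\<delta>>0. \<forall>h. 0 < h \<and> h < \<delta> \<longrightarrow> measure lebesgue ({x..x+h} - uminus ` A) \<le> \<epsilon> * h"
    using right_density_ae by blast
  have "{x \<in> A. \<not> density_point A x} \<subseteq> N \<union> uminus ` N'"
  proof (clarsimp, rule ccontr)
    fix x assume x: "x \<in> A" "\<not> density_point A x" "x \<notin> uminus ` N'" "x \<notin> N"
    have "density_point A x"
      unfolding density_point_def
    proof (intro allI impI)
      fix \<epsilon> :: real assume \<epsilon>: "0 < \<epsilon>"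
      have "-x \<in> uminus ` A - N'"
        using x by (auto simp: image_iff)
      with x \<epsilon> obtain d1 d2 where d: "0 < d1" "0 < d2"
        "\<And>h. 0 < h \<Longrightarrow> h < d1 \<Longrightarrow> measure lebesgue ({x..x+h} - A) \<le> \<epsilon> / 2 * h"
        "\<And>h. 0 < h \<Longrightarrow> h < d2 \<Longrightarrow> measure lebesgue ({-x..-x+h} - uminus ` A) \<le> \<epsilon> / 2 * h"
        using N(2)[of x "\<epsilon>/2"] N'(2)[of "-x" "\<epsilon>/2"] by auto
      have "measure lebesgue ({x-h..x+h} - A) \<le> \<epsilon> * h" if h: "0 < h" "h < min d1 d2" for h
      proof -
        have "y \<in> uminus ` S \<longleftrightarrow> - y \<in> S" for y and S :: "real set"
          by (metis image_iff minus_minus)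
        then have "{x-h..x} - A = uminus ` ({-x..-x+h} - uminus ` A)"
          by auto
        then have left: "measure lebesgue ({x-h..x} - A) \<le> \<epsilon> / 2 * h"
          using d(4)[of h] h by (simp add: measure_lebesgue_uminus_image)
        have "measure lebesgue ({x-h..x+h} - A) \<le> measure lebesgue ({x-h..x} - A \<union> ({x..x+h} - A))"
          using assms by (intro measure_mono_fmeasurable fmeasurable.Un interval_Diff_lmeasurable) auto
        also have "\<dots> \<le> measure lebesgue ({x-h..x} - A) + measure lebesgue ({x..x+h} - A)"
          using assms by (intro measure_Un_le) auto
        finally show ?thesis
          using left d(3)[of h] h by (simp add: field_simps)
      qed
      then show "\<exists>\<delta>>0. \<forall>h. 0 < h \<and> h < \<delta> \<longrightarrow> measure lebesgue ({x-h..x+h} - A) \<le> \<epsilon> * h"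
        using d by (intro exI[of _ "min d1 d2"]) auto
    qed
    with x show False by blast
  qed
  moreover have "negligible (N \<union> uminus ` N')"
    using N(1) N'(1) by (intro negligible_Un negligible_differentiable_image_negligible) (auto intro!: derivative_intros simp: differentiable_on_def)
  ultimately show ?thesis
    using negligible_subset negligible_iff_null_sets by blast
qed

section \<open>The density topology\<close>

text \<open>The density is taken over the completed measure, so every density-open set is
  measurable; it is positive everywhere, so the null sets are those of Lebesgue measure.\<close>

definition gaussian :: "real measure" where
  "gaussian = density lebesgue (\<lambda>x. ennreal (std_normal_density x))"

lemma sets_gaussian [simp, measurable_cong]: "sets gaussian = sets lebesgue"
  and space_gaussian [simp]: "space gaussian = UNIV"
  by (simp_all add: gaussian_def)

lemma std_normal_density_lebesgue_measurable: "(\<lambda>x. ennreal (std_normal_density x)) \<in> borel_measurable lebesgue"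
  by (rule measurable_completion) simp

lemma prob_space_gaussian: "prob_space gaussian"
proof
  have "emeasure gaussian (space gaussian) = (\<integral>\<^sup>+x. ennreal (std_normal_density x) \<partial>lebesgue)"
    using std_normal_density_lebesgue_measurable by (simp add: gaussian_def emeasure_density)
  also have "\<dots> = (\<integral>\<^sup>+x. ennreal (std_normal_density x) \<partial>lborel)"
    by (rule nn_integral_completion)
  also have "\<dots> = emeasure (density lborel std_normal_density) UNIV"
    by (simp add: emeasure_density)
  also have "\<dots> = 1"
    using prob_space.emeasure_space_1[OF prob_space_normal_density[of 1 0]] by simp
  finally show "emeasure gaussian (space gaussian) = 1" .
qed

lemma null_sets_gaussian: "null_sets gaussian = null_sets lebesgue"
proof -
  have pos: "ennreal (std_normal_density x) \<noteq> 0" for x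
    using normal_density_pos[of 1 0 x] by (simp add: ennreal_eq_0_iff)
  have "A \<in> null_sets gaussian \<longleftrightarrow> A \<in> null_sets lebesgue" for A
  proof (cases "A \<in> sets lebesgue")
    case True
    then show ?thesis
      unfolding gaussian_def null_sets_density_iff[OF std_normal_density_lebesgue_measurable]
      using pos AE_iff_null_sets[OF True] by simp
  next
    case False
    then show ?thesis
      using null_setsD2 sets_gaussian by blast
  qed
  then show ?thesis by blast
qed

text \<open>Exhaustion: countable subfamilies that nearly attain the supremum \<open>s\<close> of
  the measures of countable unions are merged into one that attains it. Adding a further member
  cannot increase the measure, so that member is covered up to a null set.\<close>

lemma (in finite_measure) countable_subfamily_covers_ae:
  assumes "\<U> \<subseteq> sets M"
  obtains \<V> where "countable \<V>" "\<V> \<subseteq> \<U>" "\<And>U. U \<in> \<U> \<Longrightarrow> U - \<Union>\<V> \<in> null_sets M"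
proof -
  define C where "C = {\<V>. \<V> \<subseteq> \<U> \<and> countable \<V>}"
  define s where "s = (SUP \<V>\<in>C. measure M (\<Union>\<V>))"
  have meas: "\<Union>\<V> \<in> sets M" if "\<V> \<in> C" for \<V>
    using that assms unfolding C_def by (intro sets.countable_Union) auto
  have bdd: "bdd_above ((\<lambda>\<V>. measure M (\<Union>\<V>)) ` C)"
    by (meson bdd_aboveI2 bounded_measure)
  have "{} \<in> C"
    by (simp add: C_def)
  have "\<exists>\<V>\<in>C. s - 1 / Suc n < measure M (\<Union>\<V>)" for n
    using \<open>{} \<in> C\<close> bdd less_cSUP_iff[of C "\<lambda>\<V>. measure M (\<Union>\<V>)" "s - 1 / Suc n"]
    by (force simp: s_def)
  then obtain \<W> where \<W>: "\<And>n. \<W> n \<in> C" "\<And>n. s - 1 / Suc n < measure M (\<Union>(\<W> n))"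
    by metis
  define \<V> where "\<V> = (\<Union>n. \<W> n)"
  have \<V>: "\<V> \<in> C"
    using \<W>(1) unfolding C_def \<V>_def by auto
  have "s - 1 / Suc n \<le> measure M (\<Union>\<V>)" for n
  proof -
    have "measure M (\<Union>(\<W> n)) \<le> measure M (\<Union>\<V>)"
      using meas[OF \<V>] by (intro finite_measure_mono) (auto simp: \<V>_def)
    with \<W>(2)[of n] show ?thesis by linarith
  qed
  then have "s \<le> measure M (\<Union>\<V>)"
    using LIMSEQ_le_const2[of "\<lambda>n. s - 1 / Suc n" s "measure M (\<Union>\<V>)"]
      tendsto_diff[OF tendsto_const LIMSEQ_inverse_real_of_nat, of s] by (auto simp: inverse_eq_divide)
  show thesis
  proof (rule that[of \<V>])
    fix U assume U: "U \<in> \<U>"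
    then have "insert U \<V> \<in> C"
      using \<V> by (auto simp: C_def)
    then have "measure M (U \<union> \<Union>\<V>) \<le> s"
      using cSUP_upper[OF _ bdd, of "insert U \<V>"] by (simp add: s_def)
    moreover have "measure M (U \<union> \<Union>\<V>) = measure M (\<Union>\<V>) + measure M (U - \<Union>\<V>)"
      using finite_measure_Union[of "\<Union>\<V>" "U - \<Union>\<V>"] U assms meas[OF \<V>] by (auto simp: Un_commute)
    ultimately have "measure M (U - \<Union>\<V>) = 0"
      using \<open>s \<le> measure M (\<Union>\<V>)\<close> measure_nonneg[of M "U - \<Union>\<V>"] by linarith
    then show "U - \<Union>\<V> \<in> null_sets M"
      using U assms meas[OF \<V>] by (auto simp: null_sets_def emeasure_eq_measure)
  qed (use \<V> in \<open>auto simp: C_def\<close>)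
qed

text \<open>Exhaustion covers each single member up to a null set, but there may be uncountably many
  members. Every point of a member is still a density point of \<open>\<Union>\<V>\<close>; if it
  lies outside \<open>\<Union>\<V>\<close>, it is an exceptional point of the complement in
  Lebesgue's theorem. So all uncovered points lie in one null set, and completeness makes them a
  null set.\<close>

lemma density_open_family_countable:
  assumes "\<And>U. U \<in> \<U> \<Longrightarrow> U \<in> sets lebesgue" "\<And>U x. U \<in> \<U> \<Longrightarrow> x \<in> U \<Longrightarrow> density_point U x"
  obtains \<V> where "countable \<V>" "\<V> \<subseteq> \<U>" "\<Union>\<U> - \<Union>\<V> \<in> null_sets lebesgue"
proof -
  interpret prob_space gaussian by (rule prob_space_gaussian)
  obtain \<V> where \<V>: "countable \<V>" "\<V> \<subseteq> \<U>" "\<And>U. U \<in> \<U> \<Longrightarrow> U - \<Union>\<V> \<in> null_sets lebesgue"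
    using countable_subfamily_covers_ae[of \<U>] assms(1) by (auto simp: null_sets_gaussian)
  have meas: "\<Union>\<V> \<in> sets lebesgue"
    using assms \<V> by (intro sets.countable_Union) auto
  have "\<Union>\<U> - \<Union>\<V> \<subseteq> {x \<in> - \<Union>\<V>. \<not> density_point (- \<Union>\<V>) x}"
  proof
    fix x assume "x \<in> \<Union>\<U> - \<Union>\<V>"
    then obtain U where U: "U \<in> \<U>" "x \<in> U" "x \<notin> \<Union>\<V>"
      by blast
    then have "density_point (\<Union>\<V>) x"
      using density_point_mono_ae[of U x "\<Union>\<V>"] assms meas \<V> by blast
    with U meas show "x \<in> {x \<in> - \<Union>\<V>. \<not> density_point (- \<Union>\<V>) x}"
      using density_point_Compl by auto
  qed
  moreover have "{x \<in> - \<Union>\<V>. \<not> density_point (- \<Union>\<V>) x} \<in> null_sets lebesgue"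
    using meas by (intro lebesgue_density) (auto simp: Compl_in_sets_lebesgue)
  ultimately have "\<Union>\<U> - \<Union>\<V> \<in> null_sets lebesgue"
    using null_sets_completion_subset by blast
  with \<V> show thesis
    using that by blast
qed

section \<open>Density-open sets, density interiors and connectedness\<close>

definition density_topology :: "real topology" where
  "density_topology = topology (\<lambda>U. U \<in> sets lebesgue \<and> (\<forall>x\<in>U. density_point U x))"

text \<open>The critical axiom is the measurability of arbitrary unions: each is a countable union
  of members together with a null set.\<close>

lemma openin_density_topology:
  "openin density_topology U \<longleftrightarrow> U \<in> sets lebesgue \<and> (\<forall>x\<in>U. density_point U x)"
proof -
  have "istopology (\<lambda>U. U \<in> sets lebesgue \<and> (\<forall>x\<in>U. density_point U x))"
    unfolding istopology_def
  proof (intro conjI allI impI)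
    fix \<U> assume \<U>: "\<forall>U\<in>\<U>. U \<in> sets lebesgue \<and> (\<forall>x\<in>U. density_point U x)"
    obtain \<V> where \<V>: "countable \<V>" "\<V> \<subseteq> \<U>" "\<Union>\<U> - \<Union>\<V> \<in> null_sets lebesgue"
      by (rule density_open_family_countable[of \<U>]) (use \<U> in auto)
    then have "\<Union>\<V> \<in> sets lebesgue"
      using \<U> by (intro sets.countable_Union) auto
    moreover have "\<Union>\<U> = \<Union>\<V> \<union> (\<Union>\<U> - \<Union>\<V>)"
      using \<V>(2) by blast
    ultimately show "\<Union>\<U> \<in> sets lebesgue"
      using \<V>(3) by (metis null_setsD2 sets.Un)
    then show "\<forall>x\<in>\<Union>\<U>. density_point (\<Union>\<U>) x"
      using \<U> density_point_mono[of _ _ "\<Union>\<U>"] by blast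
  qed (auto intro: density_point_Int)
  then show ?thesis
    by (simp add: density_topology_def)
qed

lemma openin_density_topology_open: "open U \<Longrightarrow> openin density_topology U"
  by (simp add: openin_density_topology density_point_open borel_open)

lemma topspace_density_topology [simp]: "topspace density_topology = UNIV"
  by (metis open_UNIV openin_density_topology_open openin_subset top.extremum_uniqueI)

lemma density_open_not_null:
  assumes "openin density_topology U" "U \<noteq> {}"
  shows "U \<notin> null_sets lebesgue"
proof
  assume *: "U \<in> null_sets lebesgue"
  obtain x where "x \<in> U" using assms by blast
  then have "density_point {} x"
    using assms * by (intro density_point_mono_ae[of U x "{}"]) (auto simp: openin_density_topology)
  moreover have "density_point UNIV x"
    by (simp add: density_point_open)
  ultimately show False
    using density_point_Compl[of "{}" x] by simp
qed

text \<open>For measurable \<open>A\<close> this is the interior in the density topology.\<close>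

definition density_interior :: "real set \<Rightarrow> real set" where
  "density_interior A = {x \<in> A. density_point A x}"

lemma density_interior:
  assumes "A \<in> sets lebesgue"
  shows "openin density_topology (density_interior A)" "A - density_interior A \<in> null_sets lebesgue"
proof -
  show *: "A - density_interior A \<in> null_sets lebesgue"
  proof -
    have "A - density_interior A = {x \<in> A. \<not> density_point A x}"
      by (auto simp: density_interior_def)
    then show ?thesis
      using lebesgue_density[OF assms] by simp
  qed
  have "density_interior A = A - (A - density_interior A)"
    by (auto simp: density_interior_def)
  then have m: "density_interior A \<in> sets lebesgue"
    using assms * by (metis null_setsD2 sets.Diff)
  then show "openin density_topology (density_interior A)"
    unfolding openin_density_topology
    using assms * density_point_mono_ae[of A _ "density_interior A"] by (auto simp: density_interior_def)
qed

lemma connected_space_density_topology: "connected_space density_topology"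
proof -
  have False if op: "openin density_topology A" "openin density_topology (- A)" and ab: "a \<in> A" "b \<notin> A" "a < b" for A a b
  proof -
    have A: "A \<in> sets lebesgue" "\<And>x. x \<in> A \<Longrightarrow> density_point A x" "\<And>x. x \<notin> A \<Longrightarrow> density_point (- A) x"
      using op by (auto simp: openin_density_topology)
    define i where "i c d = integral {c..d} (indicator A :: real \<Rightarrow> real)" for c d
    have lm: "{c..d} \<inter> A \<in> lmeasurable" for c d :: real
      using A(1) by (intro fmeasurable_Int_fmeasurable) auto
    have int: "(indicator A :: real \<Rightarrow> real) integrable_on {c..d}" for c d
      using lm by (simp add: integrable_on_indicator Int_commute)
    have i: "i c d = measure lebesgue ({c..d} \<inter> A)" for c d
      using lm unfolding i_def by (subst integral_indicator) (auto simp: Int_commute)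
    have i': "i c d = (d - c) - measure lebesgue ({c..d} - A)" if "c \<le> d" for c d
      using measurable_measure_Diff[of "{c..d}" lebesgue "{c..d} \<inter> A"] lm[of c d] that
      by (simp add: i Diff_Int fmeasurableD)
    \<comment> \<open>\<open>G\<close> has derivative \<open>-1\<close> at the points of \<open>A\<close> and \<open>1\<close> at the others, so its minimum is impossible.\<close>
    define G where "G y = y - 2 * i a y" for y
    have "continuous_on {a..b} G"
      unfolding G_def i_def by (intro continuous_intros indefinite_integral_continuous_1 int)
    then obtain z where z: "z \<in> {a..b}" "\<And>y. y \<in> {a..b} \<Longrightarrow> G z \<le> G y"
      using continuous_attains_inf[of "{a..b}" G] ab by (auto simp: less_imp_le)
    have comb: "i a d = i a c + i c d" if "a \<le> c" "c \<le> d" for c d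
      unfolding i_def using Henstock_Kurzweil_Integration.integral_combine[OF that int] by simp
    show False
    proof (cases "z \<in> A")
      case True
      \<comment> \<open>Any constant below \<open>1/2\<close> would do. With \<open>1/4\<close>, at
        least \<open>3/4\<close> of \<open>{z..z+h}\<close> lies in \<open>A\<close>, so
        \<open>G\<close> changes by at most \<open>h - 2 * (3/4) * h\<close>, which is
        negative.\<close>
      then obtain \<delta> where \<delta>: "\<delta> > 0" "\<And>h. 0 < h \<Longrightarrow> h < \<delta> \<Longrightarrow> measure lebesgue ({z-h..z+h} - A) \<le> 1/4 * h"
        using density_pointE[of A z "1/4"] A(2) by auto
      \<comment> \<open>A minimum at an endpoint is no escape: one in \<open>A\<close> is beaten on
        its right and \<open>b\<close> is not in \<open>A\<close>; one outside \<open>A\<close> is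
        beaten on its left and \<open>a\<close> is in \<open>A\<close>.\<close>
      have "z < b" using z True ab by (cases "z = b") auto
      define h where "h = min (\<delta>/2) (b - z)"
      have h: "0 < h" "h < \<delta>" "h \<le> b - z"
        using \<delta>(1) \<open>z < b\<close> by (auto simp: h_def)
      have "measure lebesgue ({z..z+h} - A) \<le> measure lebesgue ({z-h..z+h} - A)"
        using A(1) h by (intro measure_mono_fmeasurable interval_Diff_lmeasurable) auto
      then have "i z (z+h) \<ge> 3/4 * h"
        using i'[of z "z+h"] h \<delta>(2)[of h] by linarith
      then have "G (z + h) < G z"
        using comb[of z "z+h"] z(1) h unfolding G_def by auto
      then show False
        using z(2)[of "z+h"] z(1) h by auto
    next
      case False
      then obtain \<delta> where \<delta>: "\<delta> > 0" "\<And>h. 0 < h \<Longrightarrow> h < \<delta> \<Longrightarrow> measure lebesgue ({z-h..z+h} - (- A)) \<le> 1/4 * h"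
        using density_pointE[of "- A" z "1/4"] A(3) by auto
      have "a < z" using z False ab by (cases "z = a") auto
      define h where "h = min (\<delta>/2) (z - a)"
      have h: "0 < h" "h < \<delta>" "h \<le> z - a"
        using \<delta>(1) \<open>a < z\<close> by (auto simp: h_def)
      have "measure lebesgue ({z-h..z} \<inter> A) \<le> measure lebesgue ({z-h..z+h} - (- A))"
        using A(1) h by (intro measure_mono_fmeasurable interval_Diff_lmeasurable) (auto simp: fmeasurableD[OF lm] Compl_in_sets_lebesgue)
      then have "i (z-h) z \<le> 1/4 * h"
        using i[of "z-h" z] h \<delta>(2)[of h] by linarith
      then have "G (z - h) < G z"
        using comb[of "z-h" z] z(1) h unfolding G_def by auto
      then show False
        using z(2)[of "z-h"] z(1) h by auto
    qed
  qed
  note * = this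
  have False if AB: "openin density_topology A" "openin density_topology B" "UNIV \<subseteq> A \<union> B" "A \<inter> B = {}" "A \<noteq> {}" "B \<noteq> {}" for A B
  proof -
    have "B = - A" "A = - B" using AB(3,4) by auto
    moreover obtain a b where "a \<in> A" "b \<in> B" using AB by blast
    moreover have "a \<noteq> b" using AB \<open>a \<in> A\<close> \<open>b \<in> B\<close> by blast
    ultimately show False
      using *[of A a b] *[of B b a] AB(1,2) by (metis ComplD linorder_neqE)
  qed
  then show ?thesis
    unfolding connected_space_def by auto
qed

section \<open>Urysohn functions for the density topology\<close>

text \<open>A single closed approximation of \<open>E\<close> from inside may lose density at points
  of \<open>X\<close>. Therefore the approximation improves towards \<open>X\<close>: beyond
  distance \<open>(1/2)^n\<close> from \<open>X\<close>, the set \<open>P\<close> is contained in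
  \<open>T n\<close>. Non-emptiness of \<open>X\<close> matters because \<open>infdist\<close> to
  the empty set is 0.\<close>

lemma lusin_menchoff:
  assumes "closed X" "X \<noteq> {}" "E \<in> sets lebesgue" "X \<subseteq> density_interior E"
  obtains P where "closed P" "X \<subseteq> density_interior P" "P \<subseteq> E"
proof -
  have "\<exists>T. closed T \<and> T \<subseteq> E \<and> E - T \<in> lmeasurable \<and> emeasure lebesgue (E - T) < ennreal ((1/8)^n)" for n
    by (rule sets_lebesgue_inner_closed[OF assms(3), of "(1/8)^n"]) auto
  then obtain T where T: "\<And>n. closed (T n)" "\<And>n. T n \<subseteq> E" "\<And>n. E - T n \<in> lmeasurable"
    "\<And>n. emeasure lebesgue (E - T n) < ennreal ((1/8)^n)"
    by metis
  \<comment> \<open>Within distance \<open>h\<close> of \<open>X\<close> only the indices with \<open>2\<^sup>-\<^sup>n < h\<close> matter; they remove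
    from \<open>E\<close> a set of measure at most the sum of the \<open>8\<^sup>-\<^sup>n\<close>, which is \<open>O(h\<^sup>2)\<close>.\<close>
  define P where "P = (\<Inter>n. T n \<union> {x. infdist x X \<le> (1/2)^n})"
  have "closed P"
    unfolding P_def using T(1) by (intro closed_INT ballI closed_Un closed_Collect_le continuous_intros) auto
  have "X \<subseteq> P"
    by (auto simp: P_def)
  have "P \<subseteq> E"
  proof
    fix x assume x: "x \<in> P"
    show "x \<in> E"
    proof (cases "x \<in> X")
      case False
      then have "0 < infdist x X"
        using assms(1,2) by (metis in_closed_iff_infdist_zero infdist_nonneg order_le_less)
      then obtain n where "(1/2)^n < infdist x X"
        by (metis real_arch_pow_inv half_gt_zero_iff less_divide_eq_1_pos one_less_numeral_iff semiring_norm(76) zero_less_numeral zero_less_one divide_less_eq_1_pos)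
      with x have "x \<in> T n"
        by (auto simp: P_def not_le)
      then show ?thesis using T(2) by blast
    qed (use assms in \<open>auto simp: density_interior_def\<close>)
  qed
  have "density_point P x" if "x \<in> X" for x
    unfolding density_point_def
  proof (intro allI impI)
    fix \<epsilon> :: real assume \<epsilon>: "0 < \<epsilon>"
    have "density_point E x"
      using that assms by (auto simp: density_interior_def)
    then obtain d where d: "0 < d" "\<And>h. 0 < h \<Longrightarrow> h < d \<Longrightarrow> measure lebesgue ({x-h..x+h} - E) \<le> \<epsilon>/2 * h"
      using density_pointE \<epsilon> by (metis half_gt_zero)
    \<comment> \<open>The bound \<open>\<epsilon>/4\<close> on \<open>h\<close> turns the quadratic
      loss \<open>2 * h^2\<close> into at most \<open>\<epsilon>/2 * h\<close>; the other half of
      \<epsilon> is for the complement of \<open>E\<close>.\<close>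
    have "measure lebesgue ({x-h..x+h} - P) \<le> \<epsilon> * h" if h: "0 < h" "h < min d (\<epsilon>/4)" for h
    proof -
      define Q where "Q = (\<lambda>n. if (1/2)^n < h then E - T n else {})"
      have Q: "Q n \<in> lmeasurable" for n
        using T(3) by (auto simp: Q_def)
      \<comment> \<open>The number 8 is a cube: of three factors \<open>(1/2)^n\<close>, two are
        below \<open>h\<close> and give \<open>h^2\<close>, and the third makes the series
        converge.\<close>
      have mQ: "measure lebesgue (Q n) \<le> h^2 * (1/2)^n" for n
      proof (cases "(1/2)^n < h")
        case True
        have "measure lebesgue (E - T n) \<le> (1/8)^n"
          using T(4)[of n] by (simp add: measure_def enn2real_leI less_imp_le)
        also have "\<dots> = ((1/2)^n)^2 * (1/2::real)^n"
          by (simp add: power2_eq_square flip: power_mult_distrib)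
        also have "\<dots> \<le> h^2 * (1/2)^n"
          using True by (intro mult_right_mono power_mono) auto
        finally show ?thesis by (simp add: Q_def True)
      qed (simp add: Q_def)
      have sums: "(\<lambda>n. h^2 * (1/2)^n) sums (h^2 * 2)"
        using geometric_sums[of "1/2::real"] by (intro sums_mult) auto
      have summ: "summable (\<lambda>n. measure lebesgue (Q n))"
        using mQ by (intro summable_comparison_test'[OF sums_summable[OF sums], of 0]) auto
      have "(\<Sum>n. measure lebesgue (Q n)) \<le> h^2 * 2"
        using suminf_le[OF mQ summ sums_summable[OF sums]] sums_unique[OF sums] by simp
      then have fin: "measure lebesgue (\<Union>i\<in>I. Q i) \<le> h^2 * 2" if "finite I" for I
      proof -
        have "measure lebesgue (\<Union>i\<in>I. Q i) \<le> (\<Sum>i\<in>I. measure lebesgue (Q i))"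
          using Q that by (intro measure_UNION_le) auto
        also have "\<dots> \<le> (\<Sum>i. measure lebesgue (Q i))"
          using summ that by (intro sum_le_suminf) auto
        finally show ?thesis using \<open>(\<Sum>n. measure lebesgue (Q n)) \<le> h^2 * 2\<close> by linarith
      qed
      have UQ: "(\<Union>n. Q n) \<in> lmeasurable" "measure lebesgue (\<Union>n. Q n) \<le> h^2 * 2"
        using fmeasurable_UN_bound[OF _ Q fin] measure_UN_bound[OF _ Q fin] by auto
      have "{x-h..x+h} - P \<subseteq> ({x-h..x+h} - E) \<union> (\<Union>n. Q n)"
      proof
        fix y assume y: "y \<in> {x-h..x+h} - P"
        then obtain n where n: "y \<notin> T n" "(1/2)^n < infdist y X"
          by (auto simp: P_def not_le)
        have "infdist y X \<le> dist y x"
          using \<open>x \<in> X\<close> by (simp add: infdist_le)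
        also have "\<dots> \<le> h"
          using y by (auto simp: dist_real_def)
        finally show "y \<in> ({x-h..x+h} - E) \<union> (\<Union>n. Q n)"
          using n y by (auto simp: Q_def intro!: exI[of _ n])
      qed
      then have "measure lebesgue ({x-h..x+h} - P) \<le> measure lebesgue (({x-h..x+h} - E) \<union> (\<Union>n. Q n))"
        using \<open>closed P\<close> UQ assms by (intro measure_mono_fmeasurable fmeasurable.Un interval_Diff_lmeasurable) auto
      also have "\<dots> \<le> measure lebesgue ({x-h..x+h} - E) + measure lebesgue (\<Union>n. Q n)"
        using UQ assms by (intro measure_Un_le) auto
      also have "\<dots> \<le> \<epsilon>/2 * h + h * h * 2"
        using d(2)[of h] h UQ(2) by (simp add: power2_eq_square)
      also have "\<dots> \<le> \<epsilon>/2 * h + \<epsilon>/4 * h * 2"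
        using h by (intro add_left_mono mult_right_mono) auto
      also have "\<dots> = \<epsilon> * h" by simp
      finally show ?thesis .
    qed
    then show "\<exists>\<delta>>0. \<forall>h. 0 < h \<and> h < \<delta> \<longrightarrow> measure lebesgue ({x-h..x+h} - P) \<le> \<epsilon> * h"
      using d(1) \<epsilon> by (intro exI[of _ "min d (\<epsilon>/4)"]) auto
  qed
  then have "X \<subseteq> density_interior P"
    using \<open>X \<subseteq> P\<close> by (auto simp: density_interior_def)
  then show thesis
    by (rule that[OF \<open>closed P\<close> _ \<open>P \<subseteq> E\<close>])
qed

definition bump_functions :: "(real \<Rightarrow> real) set" where
  "bump_functions = {f. range f \<subseteq> {0..1} \<and> continuous_map density_topology euclideanreal f \<and>
     (\<forall>a. open {x. f x < a})}"

text \<open>The set \<open>dyadics\<close> contains only quotients of natural numbers, hence the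
  bound \<open>0 \<le> a\<close>.\<close>

lemma dyadic_between:
  fixes a b :: real
  assumes "0 \<le> a" "a < b"
  obtains d where "d \<in> dyadics" "a < d" "d < b"
proof -
  obtain n where n: "(1/2)^n < b - a"
    using real_arch_pow_inv[of "b - a" "1/2"] assms by auto
  define q where "q = nat \<lfloor>a * 2^n\<rfloor> + 1"
  have q: "a * 2^n < q" "q \<le> a * 2^n + 1"
    using assms floor_correct[of "a * 2^n"] by (simp_all add: q_def add.commute)
  have "a < q / 2^n"
    using q(1) by (simp add: field_simps)
  moreover have "q / 2^n \<le> a + (1/2)^n"
    using q(2) by (simp add: field_simps)
  ultimately show thesis
    using that[of "q / 2^n"] n by (auto simp: dyadics_def)
qed

text \<open>Urysohn's construction along the dyadic rationals: the relation \<open>A \<subseteq> density_interior B\<close>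
  between closed sets is interpolated by the Lusin--Menchoff theorem.\<close>

lemma bump_function_exists:
  assumes "E \<in> sets lebesgue" "x \<in> density_interior E"
  obtains f where "f \<in> bump_functions" "f x = 1" "\<And>y. y \<notin> E \<Longrightarrow> f y = 0"
proof -
  \<comment> \<open>Non-emptiness of the smaller set is part of \<open>R\<close> because
    \<open>lusin_menchoff\<close> asks for it at every interpolation.\<close>
  define R where "R = (\<lambda>A B. closed A \<and> closed B \<and> A \<noteq> {} \<and> A \<subseteq> density_interior B)"
  have di: "density_interior A \<subseteq> A" for A
    by (auto simp: density_interior_def)
  have sl: "A \<in> sets lebesgue" if "closed A" for A :: "real set"
    using that by (simp add: borel_closed)
  have didi: "density_interior (density_interior A) = density_interior A" if "A \<in> sets lebesgue" for A
    using density_interior(1)[OF that] by (auto simp: density_interior_def openin_density_topology)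
  obtain F where F: "closed F" "{x} \<subseteq> density_interior F" "F \<subseteq> E"
    using lusin_menchoff[of "{x}" E] assms by auto
  have "\<exists>P. P 0 = {x} \<and> P 1 = F \<and>
     (\<forall>r \<in> dyadics \<inter> {0..1::real}. \<forall>s \<in> dyadics \<inter> {0..1}. r < s \<longrightarrow> R (P r) (P s))"
  proof (rule recursion_on_dyadic_fractions)
    show "R {x} F"
      using F by (auto simp: R_def)
    show "\<exists>C. R A C \<and> R C B" if "R A B" for A B
    proof -
      have A: "closed A" "A \<noteq> {}" and B: "B \<in> sets lebesgue" "A \<subseteq> density_interior B"
        using that sl by (auto simp: R_def)
      \<comment> \<open>Lusin-Menchoff is applied to \<open>density_interior B\<close> instead of
        \<open>B\<close>, so that the inserted closed set ends up in the interior of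
        \<open>B\<close>.\<close>
      have "density_interior B \<in> sets lebesgue"
        using density_interior(1)[OF B(1)] by (simp add: openin_density_topology)
      moreover have "A \<subseteq> density_interior (density_interior B)"
        using B didi by simp
      ultimately obtain P where "closed P" "A \<subseteq> density_interior P" "P \<subseteq> density_interior B"
        using lusin_menchoff[OF A] by blast
      then show ?thesis
        using that di[of P] unfolding R_def by blast
    qed
    show "R A C" if "R A B" "R B C" for A B C
      using that di[of B] unfolding R_def by blast
  qed
  then obtain P where "P 0 = {x} \<and> P 1 = F \<and>
     (\<forall>r \<in> dyadics \<inter> {0..1::real}. \<forall>s \<in> dyadics \<inter> {0..1}. r < s \<longrightarrow> R (P r) (P s))"
    by (rule exE)
  then have P0: "P 0 = {x}" and P1: "P 1 = F"
    and P': "\<forall>r \<in> dyadics \<inter> {0..1}. \<forall>s \<in> dyadics \<inter> {0..1}. r < s \<longrightarrow> R (P r) (P s)"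
    by simp_all
  have P: "R (P r) (P s)" if "r \<in> dyadics" "s \<in> dyadics" "0 \<le> r" "r < s" "s \<le> 1" for r s
    using P' that by simp
  define D where "D = (dyadics \<inter> {0..1::real})"
  have 01: "0 \<in> D" "1 \<in> D"
    by (force simp: D_def dyadics_def)+
  have closedP: "closed (P r)" if "r \<in> D" for r
  proof (cases "r = 1")
    case False
    with that have "R (P r) (P 1)"
      using 01 by (intro P) (auto simp: D_def)
    then show ?thesis by (simp add: R_def)
  qed (simp add: P1 F)
  have monoP: "P r \<subseteq> P s" if "r \<in> D" "s \<in> D" "r \<le> s" for r s
  proof (cases "r = s")
    case False
    with that have "R (P r) (P s)"
      by (intro P) (auto simp: D_def)
    then show ?thesis using di[of "P s"] by (auto simp: R_def)
  qed simp
  \<comment> \<open>The inserted 1 keeps the set non-empty and is the value at points outside all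
    \<open>P r\<close>. As \<open>P 1 = F \<subseteq> E\<close>, it gives \<open>g = 1\<close>,
    hence \<open>f = 0\<close>, outside \<open>E\<close>.\<close>
  define g where "g = (\<lambda>y. Inf (insert 1 {r \<in> D. y \<in> P r}))"
  have bdd: "bdd_below (insert 1 {r \<in> D. y \<in> P r})" for y
    by (rule bdd_belowI[of _ 0]) (auto simp: D_def)
  have g_less: "g y < a \<longleftrightarrow> 1 < a \<or> (\<exists>r\<in>D. r < a \<and> y \<in> P r)" for y a
    unfolding g_def by (subst cInf_less_iff[OF _ bdd]) auto
  have g_le: "g y \<le> r" if "r \<in> D" "y \<in> P r" for y r
    unfolding g_def using that by (intro cInf_lower bdd) auto
  have g01: "0 \<le> g y" "g y \<le> 1" for y
  proof -
    show "0 \<le> g y"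
      unfolding g_def by (rule cInf_greatest) (auto simp: D_def)
    show "g y \<le> 1"
      unfolding g_def by (intro cInf_lower bdd) auto
  qed
  have open_less: "openin density_topology {y. g y < a}" for a
  proof (cases "1 < a")
    case False
    have "\<exists>U. openin density_topology U \<and> y \<in> U \<and> U \<subseteq> {y. g y < a}" if y: "g y < a" for y
    proof -
      obtain r where r: "r \<in> D" "r < a" "y \<in> P r"
        using y False by (auto simp: g_less)
      then obtain s where s: "s \<in> dyadics" "r < s" "s < a"
        using dyadic_between[of r a] by (auto simp: D_def)
      then have s': "s \<in> D"
        using r False by (auto simp: D_def)
      have "y \<in> density_interior (P s)"
        using P[of r s] r s False by (auto simp: R_def D_def)
      moreover have "density_interior (P s) \<subseteq> {y. g y < a}"
        using s s' di[of "P s"] by (auto simp: g_less)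
      ultimately show ?thesis
        using density_interior(1)[OF sl[OF closedP[OF s']]] by blast
    qed
    then show ?thesis
      by (subst openin_subopen) auto
  next
    case True
    then have "{y. g y < a} = topspace density_topology"
      by (auto simp: g_less)
    then show ?thesis by (metis openin_topspace)
  qed
  \<comment> \<open>Here openness is usual openness: \<open>{y. g y \<le> a}\<close> is an
    intersection of sets \<open>P r\<close>, which are closed in the usual topology. Passing to
    \<open>1 - g\<close> turns this into upper semicontinuity of \<open>f\<close>.\<close>
  have open_greater: "open {y. a < g y}" for a
  proof (cases "a < 0")
    case True
    then have "{y. a < g y} = UNIV"
      using g01 by (auto intro: less_le_trans)
    then show ?thesis by simp
  next
    case False
    have eq: "{y. g y \<le> a} = (\<Inter>r\<in>{r\<in>D. a < r}. P r)" if "a < 1"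
    proof (intro equalityI subsetI)
      fix y assume y: "y \<in> {y. g y \<le> a}"
      show "y \<in> (\<Inter>r\<in>{r\<in>D. a < r}. P r)"
      proof
        fix r assume r: "r \<in> {r\<in>D. a < r}"
        then have "g y < r" "r \<le> 1" using y by (auto simp: D_def)
        then obtain s where "s \<in> D" "s < r" "y \<in> P s"
          by (auto simp: g_less)
        then show "y \<in> P r"
          using monoP[of s r] r by auto
      qed
    next
      fix y assume y: "y \<in> (\<Inter>r\<in>{r\<in>D. a < r}. P r)"
      show "y \<in> {y. g y \<le> a}"
      proof (rule ccontr)
        assume "y \<notin> {y. g y \<le> a}"
        then have "a < g y" by auto
        then obtain r where r: "r \<in> dyadics" "a < r" "r < g y"
          using dyadic_between[of a "g y"] False by auto
        then have "r \<in> D"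
          using g01(2)[of y] False by (auto simp: D_def)
        then have "g y \<le> r"
          using y r by (intro g_le) auto
        with r show False by simp
      qed
    qed
    have "closed {y. g y \<le> a}"
    proof (cases "a < 1")
      case True
      then show ?thesis
        unfolding eq[OF True] using closedP by auto
    next
      case False
      then have "{y. g y \<le> a} = UNIV"
        using order_trans[OF g01(2), of a] by auto
      then show ?thesis by simp
    qed
    then show ?thesis
      by (simp add: closed_def not_le Collect_neg_eq[symmetric])
  qed
  define f where "f = (\<lambda>y. 1 - g y)"
  have "continuous_map density_topology euclideanreal f"
    unfolding continuous_map_upper_lower_semicontinuous_lt
  proof (intro conjI allI)
    fix a
    have "{y. a < f y} = {y. g y < 1 - a}" "{y. f y < a} = {y. 1 - a < g y}"
      by (auto simp: f_def)
    then show "openin density_topology {y \<in> topspace density_topology. a < f y}"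
      "openin density_topology {y \<in> topspace density_topology. f y < a}"
      using open_less open_greater by (auto intro: openin_density_topology_open)
  qed
  moreover have "open {y. f y < a}" for a
  proof -
    have "{y. f y < a} = {y. 1 - a < g y}"
      by (auto simp: f_def)
    then show ?thesis using open_greater by simp
  qed
  moreover have "range f \<subseteq> {0..1}"
    using g01 by (auto simp: f_def)
  ultimately have "f \<in> bump_functions"
    by (simp add: bump_functions_def)
  moreover have "f x = 1"
  proof -
    have "g x \<le> 0"
      using 01 P0 by (intro g_le) auto
    then show ?thesis using g01(1)[of x] by (simp add: f_def)
  qed
  moreover have "f y = 0" if "y \<notin> E" for y
  proof -
    have *: "{r \<in> D. y \<in> P r} = {}"
      using monoP[OF _ 01(2)] that F(3) P1 by (auto simp: D_def)
    show ?thesis by (simp only: f_def g_def *) simp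
  qed
  ultimately show thesis using that by blast
qed

section \<open>Cardinalities and regular Borel measures\<close>

lemma lepoll_iff_card_of_ordLeq: "A \<lesssim> B \<longleftrightarrow> (card_of A, card_of B) \<in> ordLeq"
  by (simp add: lepoll_def card_of_ordLeq)

lemma infinite_Times_self_eqpoll: "infinite A \<Longrightarrow> A \<times> A \<approx> A"
  by (simp add: eqpoll_iff_card_of_ordIso card_of_Times_same_infinite)

text \<open>Subsets with \<open>Suc n\<close> elements arise by inserting one element into subsets
  with \<open>n\<close> elements, so \<open>A \<times> A \<approx> A\<close> bounds every size class
  by \<open>A\<close>; there are only countably many classes.\<close>

lemma infinite_Fpow_lepoll:
  assumes "infinite A"
  shows "Fpow A \<lesssim> A"
proof -
  define S where "S n = {B. B \<subseteq> A \<and> finite B \<and> card B = n}" for n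
  have S: "S n \<lesssim> A" for n
  proof (induction n)
    case 0
    have "S 0 = {{}}"
      by (auto simp: S_def)
    then show ?case
      using assms by (simp add: finite_lepoll_infinite)
  next
    case (Suc n)
    have "S (Suc n) \<subseteq> (\<lambda>(a, B). insert a B) ` (A \<times> S n)"
    proof
      fix B assume B: "B \<in> S (Suc n)"
      then obtain a C where "B = insert a C" "a \<notin> C" "card C = n"
        by (auto simp: S_def card_Suc_eq)
      with B have "(a, C) \<in> A \<times> S n"
        by (auto simp: S_def)
      with \<open>B = insert a C\<close> show "B \<in> (\<lambda>(a, B). insert a B) ` (A \<times> S n)"
        by (intro image_eqI[of _ _ "(a, C)"]) auto
    qed
    then have "S (Suc n) \<lesssim> A \<times> S n"
      by (rule subset_image_lepoll)
    also have "A \<times> S n \<lesssim> A \<times> A"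
      using Suc by (intro times_lepoll_mono) auto
    also have "A \<times> A \<approx> A"
      using assms by (rule infinite_Times_self_eqpoll)
    finally show ?case .
  qed
  have "Fpow A = (\<Union>n. S n)"
    by (auto simp: Fpow_def S_def)
  moreover have "(card_of (\<Union>n. S n), card_of A) \<in> ordLeq"
    using assms S unfolding lepoll_iff_card_of_ordLeq
    by (intro card_of_UNION_ordLeq_infinite) (auto simp flip: lepoll_iff_card_of_ordLeq simp: infinite_le_lepoll)
  ultimately show ?thesis
    by (simp add: lepoll_iff_card_of_ordLeq)
qed

text \<open>This is where semicontinuity for the usual topology is used: it makes \<open>f\<close> determined by its
  upper bounds on rational intervals.\<close>

lemma bump_functions_lepoll_reals: "bump_functions \<lesssim> (UNIV :: real set)"
proof -
  define code where "code f = {(a, p, q). \<forall>x. of_rat p < x \<and> x < of_rat q \<longrightarrow> f x < of_rat a}" for f :: "real \<Rightarrow> real"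
  have le: "g x \<le> f x" if "f \<in> bump_functions" "code f = code g" for f g x
  proof (rule ccontr)
    assume "\<not> g x \<le> f x"
    then obtain a where a: "f x < of_rat a" "of_rat a < g x"
      using of_rat_dense[of "f x" "g x"] by auto
    have "open {y. f y < of_rat a}"
      using that by (simp add: bump_functions_def)
    then obtain e where e: "0 < e" "ball x e \<subseteq> {y. f y < of_rat a}"
      using a by (metis mem_Collect_eq openE)
    obtain p where p: "x - e < of_rat p" "of_rat p < x"
      using of_rat_dense[of "x - e" x] e by auto
    obtain q where q: "x < of_rat q" "of_rat q < x + e"
      using of_rat_dense[of x "x + e"] e by auto
    have "(a, p, q) \<in> code f"
      using e(2) p q by (auto simp: code_def subset_iff dist_real_def)
    then have "(a, p, q) \<in> code g"
      using that(2) by simp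
    then show False
      using p q a by (auto simp: code_def)
  qed
  \<comment> \<open>Triples of rationals are numbered by naturals, so a function is encoded by a set
    of naturals.\<close>
  have "inj_on (\<lambda>f. to_nat ` code f) bump_functions"
  proof (rule inj_onI)
    fix f g assume fg: "f \<in> bump_functions" "g \<in> bump_functions" "to_nat ` code f = to_nat ` code g"
    then have "code f = code g"
      by (simp add: inj_image_eq_iff)
    then show "f = g"
      using le fg by (metis antisym ext)
  qed
  then have "bump_functions \<lesssim> (UNIV :: nat set set)"
    by (auto simp: lepoll_def)
  also have "\<dots> \<approx> (UNIV :: real set)"
    by (rule nat_sets_eqpoll_reals)
  finally show ?thesis .
qed

section \<open>Borel sets and regularity of finite measures\<close>

lemma space_borel_of [simp]: "space (borel_of X) = topspace X"
  by (simp add: borel_of_def space_measure_of_conv)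

lemma sets_borel_of: "sets (borel_of X) = sigma_sets (topspace X) {U. openin X U}"
  unfolding borel_of_def by (intro sets_measure_of) (auto dest: openin_subset)

lemma sets_borel_of_openin [intro]: "openin X U \<Longrightarrow> U \<in> sets (borel_of X)"
  by (simp add: sets_borel_of)

lemma sets_borel_of_closedin [intro]: "closedin X C \<Longrightarrow> C \<in> sets (borel_of X)"
  by (metis closedin_def double_diff sets.compl_sets sets_borel_of_openin space_borel_of subset_refl)

text \<open>The sets that can be squeezed between a closed and an open set with small difference
  form a sigma-algebra. Inner approximation of open sets by closed ones, the hypothesis
  \<open>inner\<close>, puts the generators into it.\<close>

lemma borel_regular_approx:
  assumes M: "finite_measure M" "sets M = sets (borel_of X)"
    and inner: "\<And>U \<epsilon>. openin X U \<Longrightarrow> 0 < \<epsilon> \<Longrightarrow> \<exists>C. closedin X C \<and> C \<subseteq> U \<and> measure M (U - C) < \<epsilon>"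
    and "A \<in> sets M" "0 < \<epsilon>"
  obtains C U where "closedin X C" "openin X U" "C \<subseteq> A" "A \<subseteq> U" "measure M (U - C) < \<epsilon>"
proof -
  interpret finite_measure M by fact
  have op: "U \<in> sets M" if "openin X U" for U
    using that M(2) by auto
  have cl: "C \<in> sets M" if "closedin X C" for C
    using that M(2) by auto
  have "\<forall>\<epsilon>>0. \<exists>C U. closedin X C \<and> openin X U \<and> C \<subseteq> A \<and> A \<subseteq> U \<and> measure M (U - C) < \<epsilon>"
    using \<open>A \<in> sets M\<close> unfolding M(2) sets_borel_of
  proof (induction rule: sigma_sets.induct)
    case (Basic U)
    then show ?case
      using inner[of U] by blast
  next
    case Empty
    show ?case
      by (intro allI impI exI[of _ "{}"]) auto
  next
    case (Compl A)
    show ?case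
    proof (intro allI impI)
      fix \<epsilon> :: real assume "0 < \<epsilon>"
      then obtain C U where CU: "closedin X C" "openin X U" "C \<subseteq> A" "A \<subseteq> U" "measure M (U - C) < \<epsilon>"
        using Compl.IH by meson
      have "topspace X - C - (topspace X - U) = U - C"
        using CU openin_subset by blast
      with CU show "\<exists>C U. closedin X C \<and> openin X U \<and> C \<subseteq> topspace X - A \<and> topspace X - A \<subseteq> U \<and> measure M (U - C) < \<epsilon>"
        by (intro exI[of _ "topspace X - U"] exI[of _ "topspace X - C"]) auto
    qed
  next
    case (Union A)
    show ?case
    proof (intro allI impI)
      fix \<epsilon> :: real assume \<epsilon>: "0 < \<epsilon>"
      \<comment> \<open>These errors sum to \<open>\<epsilon>/2\<close>; the other half is kept for
        truncating the union of the closed sets.\<close>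
      have "\<exists>C U. closedin X C \<and> openin X U \<and> C \<subseteq> A n \<and> A n \<subseteq> U \<and> measure M (U - C) < \<epsilon>/4 * (1/2)^n" for n
        using Union.IH[of n] \<epsilon> by (elim allE[of _ "\<epsilon>/4 * (1/2)^n"]) simp
      then obtain C U where CU: "\<And>n. closedin X (C n)" "\<And>n. openin X (U n)" "\<And>n. C n \<subseteq> A n" "\<And>n. A n \<subseteq> U n"
        "\<And>n. measure M (U n - C n) < \<epsilon>/4 * (1/2)^n"
        by metis
      have sums: "(\<lambda>n. \<epsilon>/4 * (1/2)^n) sums (\<epsilon>/2)"
        using sums_mult[OF geometric_sums[of "1/2::real"], of "\<epsilon>/4"] by simp
      have summ: "summable (\<lambda>n. measure M (U n - C n))"
        using CU(5) by (intro summable_comparison_test'[OF sums_summable[OF sums], of 0]) (auto simp: less_imp_le)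
      have "measure M (\<Union>n. U n - C n) \<le> (\<Sum>n. measure M (U n - C n))"
        using CU summ by (intro finite_measure_subadditive_countably) (auto intro: op cl)
      also have "\<dots> \<le> \<epsilon>/2"
        using suminf_le[OF _ summ sums_summable[OF sums]] CU(5) sums_unique[OF sums] by (simp add: less_imp_le)
      finally have 1: "measure M (\<Union>n. U n - C n) \<le> \<epsilon>/2" .
      \<comment> \<open>A countable union of closed sets need not be closed, so it is replaced by a
        finite one of almost the same measure.\<close>
      define K where "K n = (\<Union>i\<le>n. C i)" for n
      have "(\<lambda>n. measure M (K n)) \<longlonglongrightarrow> measure M (\<Union>n. K n)"
        using CU(1) unfolding K_def by (intro finite_Lim_measure_incseq) (force simp: incseq_def intro: cl)+
      then obtain n where "\<bar>measure M (K n) - measure M (\<Union>n. K n)\<bar> < \<epsilon>/2"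
        using \<epsilon> unfolding LIMSEQ_iff by (metis half_gt_zero order_refl real_norm_def)
      then have "measure M (\<Union>n. K n) - measure M (K n) < \<epsilon>/2"
        by linarith
      moreover have "(\<Union>n. K n) = (\<Union>n. C n)"
        by (auto simp: K_def)
      moreover have Kn: "closedin X (K n)" "K n \<subseteq> (\<Union>n. C n)"
        using CU(1) unfolding K_def by (auto intro: closedin_Union)
      moreover have Cs: "(\<Union>n. C n) \<in> sets M"
        using CU(1) cl by auto
      ultimately have 2: "measure M ((\<Union>n. C n) - K n) < \<epsilon>/2"
        using finite_measure_Diff[of "\<Union>n. C n" "K n"] cl by auto
      have Us: "openin X (\<Union>n. U n)"
        using CU(2) by auto
      have [measurable]: "\<And>n. U n \<in> sets M" "\<And>n. C n \<in> sets M" "K n \<in> sets M"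
        using CU Kn op cl by auto
      have "measure M ((\<Union>n. U n) - K n) \<le> measure M ((\<Union>n. U n - C n) \<union> ((\<Union>n. C n) - K n))"
        by (intro finite_measure_mono) (auto simp: K_def)
      also have "\<dots> \<le> measure M (\<Union>n. U n - C n) + measure M ((\<Union>n. C n) - K n)"
        by (intro measure_Un_le) auto
      also have "\<dots> < \<epsilon>"
        using 1 2 by simp
      finally have "measure M ((\<Union>n. U n) - K n) < \<epsilon>" .
      moreover have "K n \<subseteq> (\<Union>n. A n)" "(\<Union>n. A n) \<subseteq> (\<Union>n. U n)"
      proof -
        show "K n \<subseteq> (\<Union>n. A n)"
          using Kn(2) UN_mono[of UNIV UNIV C A] CU(3) by (meson order_trans subset_refl)
        show "(\<Union>n. A n) \<subseteq> (\<Union>n. U n)"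
          using CU(4) by (intro UN_mono) auto
      qed
      ultimately show "\<exists>C U. closedin X C \<and> openin X U \<and> C \<subseteq> (\<Union>i. A i) \<and> (\<Union>i. A i) \<subseteq> U \<and> measure M (U - C) < \<epsilon>"
        using Us Kn(1) by (intro exI[of _ "K n"] exI[of _ "\<Union>n. U n"] conjI)
    qed
  qed
  then have "\<exists>C U. closedin X C \<and> openin X U \<and> C \<subseteq> A \<and> A \<subseteq> U \<and> measure M (U - C) < \<epsilon>"
    using \<open>0 < \<epsilon>\<close> by simp
  then show thesis
    by (elim exE conjE) (rule that)
qed

text \<open>Smallness of \<open>U - C\<close> bounds both \<open>A - C\<close> and
  \<open>U - A\<close>, hence gives both halves of regularity; closed sets are compact here.\<close>

lemma regular_measureI:
  assumes M: "finite_measure M" "sets M = sets (borel_of X)" and "compact_space X"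
    and inner: "\<And>U \<epsilon>. openin X U \<Longrightarrow> 0 < \<epsilon> \<Longrightarrow> \<exists>C. closedin X C \<and> C \<subseteq> U \<and> measure M (U - C) < \<epsilon>"
    and comp: "\<And>C. compactin X C \<Longrightarrow> closedin X C"
  shows "regular_measure X M"
  unfolding regular_measure_def
proof (intro ballI conjI)
  interpret finite_measure M by fact
  have op: "U \<in> sets M" if "openin X U" for U
    using that M(2) by auto
  have cl: "C \<in> sets M" if "closedin X C" for C
    using that M(2) by auto
  fix A assume A: "A \<in> sets M"
  have split: "emeasure M U \<le> emeasure M C + ennreal e"
    if "U \<in> sets M" "C \<in> sets M" "measure M (U - C) < e" for U C e
  proof -
    have "emeasure M U \<le> emeasure M (C \<union> (U - C))"
      using that by (intro emeasure_mono) auto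
    also have "\<dots> \<le> emeasure M C + emeasure M (U - C)"
      using that by (intro emeasure_subadditive) auto
    also have "\<dots> \<le> emeasure M C + ennreal e"
      using that(3) by (intro add_left_mono) (simp add: emeasure_eq_measure ennreal_leI)
    finally show ?thesis .
  qed
  show "emeasure M A = (SUP C\<in>{C. compactin X C \<and> C \<subseteq> A}. emeasure M C)"
  proof (rule antisym)
    show "emeasure M A \<le> (SUP C\<in>{C. compactin X C \<and> C \<subseteq> A}. emeasure M C)"
    proof (rule ennreal_le_epsilon)
      fix e :: real assume "0 < e"
      then obtain C U where CU: "closedin X C" "openin X U" "C \<subseteq> A" "A \<subseteq> U" "measure M (U - C) < e"
        using borel_regular_approx[OF M inner A] by metis
      have "measure M (A - C) \<le> measure M (U - C)"
        using CU by (intro finite_measure_mono) (auto intro: op cl)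
      then have "emeasure M A \<le> emeasure M C + ennreal e"
        using CU A by (intro split) (auto intro: cl)
      also have "emeasure M C \<le> (SUP C\<in>{C. compactin X C \<and> C \<subseteq> A}. emeasure M C)"
        using CU \<open>compact_space X\<close> by (intro SUP_upper) (auto intro: closedin_compact_space)
      finally show "emeasure M A \<le> (SUP C\<in>{C. compactin X C \<and> C \<subseteq> A}. emeasure M C) + ennreal e"
        by (simp add: add_right_mono)
    qed
    show "(SUP C\<in>{C. compactin X C \<and> C \<subseteq> A}. emeasure M C) \<le> emeasure M A"
      using A by (intro SUP_least emeasure_mono) auto
  qed
  show "emeasure M A = (INF U\<in>{U. openin X U \<and> A \<subseteq> U}. emeasure M U)"
  proof (rule antisym)
    show "emeasure M A \<le> (INF U\<in>{U. openin X U \<and> A \<subseteq> U}. emeasure M U)"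
      by (intro INF_greatest emeasure_mono) (auto intro: op)
    show "(INF U\<in>{U. openin X U \<and> A \<subseteq> U}. emeasure M U) \<le> emeasure M A"
    proof (rule ennreal_le_epsilon)
      fix e :: real assume "0 < e"
      then obtain C U where CU: "closedin X C" "openin X U" "C \<subseteq> A" "A \<subseteq> U" "measure M (U - C) < e"
        using borel_regular_approx[OF M inner A] by metis
      have "measure M (U - A) \<le> measure M (U - C)"
        using CU A by (intro finite_measure_mono) (auto intro: op cl)
      then have "emeasure M U \<le> emeasure M A + ennreal e"
        using CU A by (intro split) (auto intro: op)
      moreover have "(INF U\<in>{U. openin X U \<and> A \<subseteq> U}. emeasure M U) \<le> emeasure M U"
        using CU by (intro INF_lower) auto
      ultimately show "(INF U\<in>{U. openin X U \<and> A \<subseteq> U}. emeasure M U) \<le> emeasure M A + ennreal e"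
        by simp
    qed
  qed
qed

section \<open>Normal measures\<close>

lemma cont_funs_measurable:
  assumes "f \<in> cont_funs X" "sets M = sets (borel_of X)"
  shows "f \<in> borel_measurable M"
proof (rule borel_measurableI)
  fix S :: "real set" assume "open S"
  then have "openin X {x \<in> topspace X. f x \<in> S}"
    using assms(1) by (auto simp: cont_funs_def intro: openin_continuous_map_preimage)
  moreover have "f -` S \<inter> space M = {x \<in> topspace X. f x \<in> S}"
    using sets_eq_imp_space_eq[OF assms(2)] by auto
  ultimately show "f -` S \<inter> space M \<in> sets M"
    using assms(2) by auto
qed

lemma cont_funs_bounded:
  assumes "f \<in> cont_funs X" "compact_space X"
  obtains B where "0 < B" "\<And>x. x \<in> topspace X \<Longrightarrow> \<bar>f x\<bar> \<le> B"
proof -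
  have "compactin euclideanreal (f ` topspace X)"
    using assms by (intro image_compactin[of X]) (auto simp: cont_funs_def compact_space_def)
  then have "bounded (f ` topspace X)"
    by (simp add: compact_imp_bounded)
  then show thesis
    using that by (auto simp: bounded_pos)
qed

lemma cont_funs_integrable:
  assumes "f \<in> cont_funs X" "sets M = sets (borel_of X)" "compact_space X" "finite_measure M"
  shows "integrable M f"
proof -
  interpret finite_measure M by fact
  obtain B where "\<And>x. x \<in> topspace X \<Longrightarrow> \<bar>f x\<bar> \<le> B"
    using cont_funs_bounded assms by metis
  then show ?thesis
    using cont_funs_measurable[OF assms(1,2)] sets_eq_imp_space_eq[OF assms(2)]
    by (intro integrable_const_bound[of _ B]) auto
qed

lemma integral_eq_SUP_directed:
  assumes X: "compact_space X" "Hausdorff_space X"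
    and M: "sets M = sets (borel_of X)" "prob_space M" "is_support_of X M"
    and int: "\<And>F. closedin X F \<Longrightarrow> 0 < measure M F \<Longrightarrow> X interior_of F \<noteq> {}"
    and D: "D \<subseteq> cont_funs X" "D \<noteq> {}" "upward_directed X D" "cont_is_sup X D f"
  shows "integral\<^sup>L M f = (SUP g\<in>D. integral\<^sup>L M g)"
proof (rule antisym)
  interpret prob_space M by fact
  have sp: "space M = topspace X"
    using sets_eq_imp_space_eq[OF M(1)] by simp
  have op: "U \<in> sets M" if "openin X U" for U
    using that M(1) by auto
  have cl: "C \<in> sets M" if "closedin X C" for C
    using that M(1) by auto
  have integ: "integrable M g" if "g \<in> cont_funs X" for g
    using cont_funs_integrable[OF that M(1) X(1)] finite_measure_axioms by blast
  have f: "f \<in> cont_funs X" "\<And>g x. g \<in> D \<Longrightarrow> x \<in> topspace X \<Longrightarrow> g x \<le> f x"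
    using D(4) by (auto simp: cont_is_sup_def cont_le_def)
  have mono: "integral\<^sup>L M g \<le> integral\<^sup>L M h"
    if "g \<in> cont_funs X" "h \<in> cont_funs X" "cont_le X g h" for g h
    using that integ sp by (intro integral_mono) (auto simp: cont_le_def)
  have le: "integral\<^sup>L M g \<le> integral\<^sup>L M f" if "g \<in> D" for g
    using that D f by (intro mono) (auto simp: cont_le_def)
  show "(SUP g\<in>D. integral\<^sup>L M g) \<le> integral\<^sup>L M f"
    using D(2) le by (rule cSUP_least)
  define m where "m = (SUP g\<in>D. integral\<^sup>L M g)"
  have bdd: "bdd_above (integral\<^sup>L M ` D)"
    using le by (intro bdd_aboveI2)
  have m: "integral\<^sup>L M g \<le> m" if "g \<in> D" for g
    unfolding m_def using that bdd by (rule cSUP_upper)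
  show "integral\<^sup>L M f \<le> (SUP g\<in>D. integral\<^sup>L M g)"
    unfolding m_def[symmetric]
  proof (rule ccontr)
    assume "\<not> integral\<^sup>L M f \<le> m"
    define c where "c = integral\<^sup>L M f - m"
    have "0 < c"
      using \<open>\<not> integral\<^sup>L M f \<le> m\<close> by (simp add: c_def)
    have "\<exists>g\<in>D. m - 1 / Suc n < integral\<^sup>L M g" for n
      using less_cSUP_iff[OF D(2) bdd, of "m - 1 / Suc n"] by (simp add: m_def)
    then obtain g where g: "\<And>n. g n \<in> D" "\<And>n. m - 1 / Suc n < integral\<^sup>L M (g n)"
      by metis
    obtain J where J: "\<And>h k. h \<in> D \<Longrightarrow> k \<in> D \<Longrightarrow> J h k \<in> D \<and> cont_le X h (J h k) \<and> cont_le X k (J h k)"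
      using D(3) unfolding upward_directed_def by metis
    \<comment> \<open>Choosing upper bounds recursively makes the sequence increasing while each
      \<open>h n\<close> still dominates \<open>g n\<close>.\<close>
    define h where "h = rec_nat (g 0) (\<lambda>n h. J h (g (Suc n)))"
    have h0: "h 0 = g 0" and hS: "\<And>n. h (Suc n) = J (h n) (g (Suc n))"
      by (auto simp: h_def)
    have hD: "h n \<in> D" for n
      by (induction n) (auto simp: h0 hS g J)
    have hC: "h n \<in> cont_funs X" for n
      using hD D(1) by blast
    have hg: "cont_le X (g n) (h n)" for n
    proof (cases n)
      case (Suc k)
      then show ?thesis
        using J[OF hD g(1), of k "Suc k"] by (simp add: hS)
    qed (simp add: h0 cont_le_def)
    have h_mono: "h i x \<le> h j x" if "i \<le> j" "x \<in> topspace X" for i j x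
    proof -
      have "h n x \<le> h (Suc n) x" for n
        using J[OF hD g(1), of n "Suc n"] that by (auto simp: hS cont_le_def)
      then show ?thesis
        using lift_Suc_mono_le[of "\<lambda>n. h n x"] that by blast
    qed
    have hm: "m - 1 / Suc n < integral\<^sup>L M (h n)" for n
      using g(2)[of n] mono[OF _ hC hg, of n] g(1) D(1) by fastforce
    have diffC: "(\<lambda>x. f x - h n x) \<in> cont_funs X" for n
      using f(1) hC by (auto simp: cont_funs_def intro: continuous_map_diff)
    \<comment> \<open>One bound serves all \<open>n\<close>, because
      \<open>0 \<le> f - h n \<le> f - h 0\<close>.\<close>
    obtain K where K: "0 < K" "\<And>x. x \<in> topspace X \<Longrightarrow> \<bar>f x - h 0 x\<bar> \<le> K"
      using cont_funs_bounded[OF diffC X(1)] by metis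
    define F where "F n = {x \<in> topspace X. c/2 \<le> f x - h n x}" for n
    have F_cl: "closedin X (F n)" for n
    proof -
      have "closedin X {x \<in> topspace X. f x - h n x \<in> {c/2..}}"
        using diffC by (intro closedin_continuous_map_preimage[of _ euclideanreal]) (auto simp: cont_funs_def)
      then show ?thesis by (simp add: F_def)
    qed
    have F_big: "c / (2 * K) \<le> measure M (F n)" for n
    proof -
      have "c \<le> integral\<^sup>L M (\<lambda>x. f x - h n x)"
        using m[OF hD] integ[OF f(1)] integ[OF hC] by (simp add: c_def)
      also have "\<dots> \<le> integral\<^sup>L M (\<lambda>x. c/2 + K * indicator (F n) x)"
      proof (rule integral_mono)
        show "integrable M (\<lambda>x. f x - h n x)"
          using integ[OF diffC] .
        show "integrable M (\<lambda>x. c/2 + K * indicator (F n) x)"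
          using cl[OF F_cl] by (auto simp: emeasure_eq_measure)
        fix x assume "x \<in> space M"
        then have "x \<in> topspace X" by (simp add: sp)
        then show "f x - h n x \<le> c/2 + K * indicator (F n) x"
          using K(2)[of x] h_mono[of 0 n x] \<open>0 < c\<close> by (auto simp: F_def indicator_def)
      qed
      also have "\<dots> = c/2 + K * measure M (F n)"
        using cl[OF F_cl] by (simp add: prob_space emeasure_eq_measure)
      finally show ?thesis
        using K(1) by (simp add: field_simps)
    qed
    have "decseq F"
      unfolding decseq_def F_def using h_mono by (fastforce intro: order_trans)
    then have "(\<lambda>n. measure M (F n)) \<longlonglongrightarrow> measure M (\<Inter>n. F n)"
      using cl[OF F_cl] by (intro finite_Lim_measure_decseq) auto
    then have "c / (2 * K) \<le> measure M (\<Inter>n. F n)"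
      using F_big by (intro LIMSEQ_le_const) auto
    then have "0 < measure M (\<Inter>n. F n)"
      using \<open>0 < c\<close> K(1) by (smt (verit) divide_pos_pos mult_pos_pos)
    moreover have "closedin X (\<Inter>n. F n)"
      using F_cl by auto
    ultimately obtain x where x: "x \<in> X interior_of (\<Inter>n. F n)"
      using int by blast
    define W where "W = X interior_of (\<Inter>n. F n)"
    have W: "openin X W" "x \<in> W" "\<And>n. W \<subseteq> F n"
      using x interior_of_subset[of X "\<Inter>n. F n"] by (auto simp: W_def)
    have WX: "W \<subseteq> topspace X"
      using W(1) openin_subset by blast
    \<comment> \<open>The sequence nearly exhausts the integrals, so no other member of
      \<open>D\<close> can gain on it. If \<open>k\<close> violated the bound at \<open>y\<close>,
      it would exceed every \<open>h n\<close> by \<delta> on an open \<open>V\<close> of positive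
      measure; an upper bound of \<open>h n\<close> and \<open>k\<close> in \<open>D\<close> would
      then gain at least \<open>\<delta> * measure M V\<close>, which is too much for large
      \<open>n\<close>.\<close>
    have g_le: "k y \<le> f y - c/2" if k: "k \<in> D" and y: "y \<in> W" for k y
    proof (rule ccontr)
      assume "\<not> k y \<le> f y - c/2"
      define \<delta> where "\<delta> = (k y - (f y - c/2)) / 2"
      have \<delta>: "0 < \<delta>" "f y - c/2 + \<delta> < k y"
        using \<open>\<not> k y \<le> f y - c/2\<close> by (simp_all add: \<delta>_def field_simps)
      define V where "V = W \<inter> {z \<in> topspace X. k z - f z \<in> {\<delta> - c/2<..}}"
      have "openin X V"
        unfolding V_def using W(1) k D(1) f(1)
        by (intro openin_Int openin_continuous_map_preimage[of _ euclideanreal] continuous_map_diff)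
          (auto simp: cont_funs_def)
      moreover have "y \<in> V"
        using y \<delta> WX by (auto simp: V_def)
      ultimately have V: "V \<in> sets M" "0 < measure M V"
        using M(3) op by (auto simp: is_support_of_def)
      obtain n where n: "1 / Suc n < \<delta> * measure M V"
        using nat_approx_posE[of "\<delta> * measure M V"] V \<delta>(1) by auto
      define p where "p = J (h n) k"
      have p: "p \<in> D" "\<And>z. z \<in> topspace X \<Longrightarrow> h n z \<le> p z" "\<And>z. z \<in> topspace X \<Longrightarrow> k z \<le> p z"
        using J[OF hD k] by (auto simp: p_def cont_le_def)
      have "integral\<^sup>L M (\<lambda>z. h n z + \<delta> * indicator V z) \<le> integral\<^sup>L M p"
      proof (rule integral_mono)
        show "integrable M (\<lambda>z. h n z + \<delta> * indicator V z)"
          using integ[OF hC] V by (auto simp: emeasure_eq_measure)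
        show "integrable M p"
          using p D(1) integ by blast
        fix z assume "z \<in> space M"
        then have z: "z \<in> topspace X" by (simp add: sp)
        show "h n z + \<delta> * indicator V z \<le> p z"
        proof (cases "z \<in> V")
          case True
          then have "z \<in> F n" "\<delta> - c/2 < k z - f z"
            using W(3)[of n] by (auto simp: V_def)
          with True p(3)[OF z] show ?thesis
            by (simp add: F_def)
        qed (use p(2)[OF z] in simp)
      qed
      also have "integral\<^sup>L M (\<lambda>z. h n z + \<delta> * indicator V z) = integral\<^sup>L M (h n) + \<delta> * measure M V"
        using integ[OF hC] V by (simp add: emeasure_eq_measure)
      finally show False
        using hm[of n] n m[OF p(1)] by linarith
    qed
    \<comment> \<open>The function \<open>b\<close> is 1 at \<open>x\<close> and 0 outside
      \<open>W\<close>, so subtracting \<open>c/2 * b\<close> lowers \<open>f\<close> only where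
      \<open>g_le\<close> leaves room.\<close>
    have "normal_space X"
      using X compact_Hausdorff_or_regular_imp_normal_space by blast
    moreover have "closedin X (topspace X - W)"
      using W(1) by blast
    moreover have "closedin X {x}"
      using X(2) W(2) WX by (simp add: Hausdorff_imp_t1_space closedin_t1_singleton subsetD)
    moreover have "disjnt (topspace X - W) {x}"
      using W(2) by (simp add: disjnt_def)
    ultimately obtain b where b: "continuous_map X (top_of_set {0..1::real}) b" "b ` (topspace X - W) \<subseteq> {0}" "b ` {x} \<subseteq> {1}"
      using zero_le_one by (rule Urysohn_lemma)
    define u where "u = (\<lambda>z. f z - c/2 * b z)"
    have bc: "continuous_map X euclideanreal b" "\<And>z. z \<in> topspace X \<Longrightarrow> b z \<in> {0..1}"
      using b(1) by (auto simp: continuous_map_in_subtopology)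
    have "u \<in> cont_funs X"
      using f(1) bc(1) unfolding u_def cont_funs_def mem_Collect_eq
      by (intro continuous_map_diff continuous_map_real_mult continuous_map_const[THEN iffD2]) auto
    moreover have "cont_le X k u" if "k \<in> D" for k
      unfolding cont_le_def
    proof
      fix z assume z: "z \<in> topspace X"
      show "k z \<le> u z"
      proof (cases "z \<in> W")
        case True
        have "c/2 * b z \<le> c/2 * 1"
          using bc(2)[OF z] \<open>0 < c\<close> by (intro mult_left_mono) auto
        then show ?thesis
          using g_le[OF that True] by (simp add: u_def)
      next
        case False
        then have "b z = 0" using b(2) z by auto
        then show ?thesis
          using f(2)[OF that z] by (simp add: u_def)
      qed
    qed
    ultimately have "cont_le X f u"
      using D(4) by (auto simp: cont_is_sup_def)
    then have "f x \<le> u x"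
      using W(2) WX by (auto simp: cont_le_def)
    then show False
      using b(3) \<open>0 < c\<close> by (simp add: u_def)
  qed
qed

lemma cont_is_inf_uminus:
  assumes "cont_is_inf X D f"
  shows "cont_is_sup X ((\<lambda>g x. - g x) ` D) (\<lambda>x. - f x)"
proof -
  have C: "(\<lambda>x. - g x) \<in> cont_funs X" if "g \<in> cont_funs X" for g
    using that by (auto simp: cont_funs_def intro: continuous_map_minus)
  have "cont_le X (\<lambda>x. - f x) h" if h: "h \<in> cont_funs X" "\<And>g. g \<in> D \<Longrightarrow> cont_le X (\<lambda>x. - g x) h" for h
  proof -
    have "cont_le X (\<lambda>x. - h x) g" if "g \<in> D" for g
      using h(2)[OF that] by (fastforce simp: cont_le_def)
    then have "cont_le X (\<lambda>x. - h x) f"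
      using assms C[OF h(1)] by (auto simp: cont_is_inf_def)
    then show ?thesis
      by (fastforce simp: cont_le_def)
  qed
  then show ?thesis
    using assms C by (auto simp: cont_is_inf_def cont_is_sup_def cont_le_def)
qed

lemma normal_measureI:
  assumes X: "compact_space X" "Hausdorff_space X"
    and M: "sets M = sets (borel_of X)" "prob_space M" "is_support_of X M"
    and int: "\<And>F. closedin X F \<Longrightarrow> 0 < measure M F \<Longrightarrow> X interior_of F \<noteq> {}"
  shows "normal_measure X M"
  unfolding normal_measure_def order_continuous_functional_def
proof (intro conjI allI impI; elim conjE)
  fix D f assume D: "D \<subseteq> cont_funs X" "D \<noteq> {}" "upward_directed X D" "cont_is_sup X D f"
  then show "integral\<^sup>L M f = (SUP g\<in>D. integral\<^sup>L M g)"
    using integral_eq_SUP_directed[OF X M int] by blast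
next
  fix D f assume D: "D \<subseteq> cont_funs X" "D \<noteq> {}" "downward_directed X D" "cont_is_inf X D f"
  let ?D = "(\<lambda>g x. - g x) ` D"
  have "integral\<^sup>L M (\<lambda>x. - f x) = (SUP g\<in>?D. integral\<^sup>L M g)"
  proof (rule integral_eq_SUP_directed[OF X M int])
    show "?D \<subseteq> cont_funs X"
      using D(1) by (auto simp: cont_funs_def intro!: continuous_map_minus)
    show "upward_directed X ?D"
      using D(3) unfolding upward_directed_def downward_directed_def cont_le_def by fastforce
    show "cont_is_sup X ?D (\<lambda>x. - f x)"
      using D(4) by (rule cont_is_inf_uminus)
  qed (use D in auto)
  also have "\<dots> = (SUP g\<in>D. - integral\<^sup>L M g)"
    by (simp add: image_image)
  finally show "integral\<^sup>L M f = (INF g\<in>D. integral\<^sup>L M g)"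
    by (simp add: Inf_real_def image_image)
qed

section \<open>The compactification and its measure\<close>

text \<open>Indexing by reals makes the number of coordinates of the product equal to the continuum,
  which bounds the weight. Repeated coordinates do no harm, so a surjection is enough.\<close>

definition bump_index :: "real \<Rightarrow> real \<Rightarrow> real" where
  "bump_index = (SOME \<phi>. range \<phi> = bump_functions)"

lemma range_bump_index: "range bump_index = bump_functions"
proof -
  obtain f where f: "f \<in> bump_functions"
    by (rule bump_function_exists[of UNIV 0]) (auto simp: density_interior_def density_point_open)
  obtain g :: "real \<Rightarrow> real \<Rightarrow> real" where g: "bump_functions \<subseteq> range g"
    using bump_functions_lepoll_reals by (auto simp: lepoll_iff)
  have "range (\<lambda>r. if g r \<in> bump_functions then g r else f) = bump_functions"
    using f g by (auto simp: image_iff subset_iff)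
  then show ?thesis
    unfolding bump_index_def by (rule someI[where P = "\<lambda>\<phi>. range \<phi> = bump_functions"])
qed

lemma bump_indexE:
  assumes "f \<in> bump_functions"
  obtains r where "bump_index r = f"
  using assms range_bump_index by (metis imageE)

lemma bump_index_in: "bump_index r \<in> bump_functions"
  using range_bump_index by blast

abbreviation real_product :: "(real \<Rightarrow> real) topology" where
  "real_product \<equiv> product_topology (\<lambda>_. euclideanreal) UNIV"

text \<open>The evaluation map, as in Tychonoff's embedding into a cube.\<close>

definition density_embedding :: "real \<Rightarrow> real \<Rightarrow> real" where
  "density_embedding x = (\<lambda>r. bump_index r x)"

definition density_compactification :: "(real \<Rightarrow> real) topology" where
  "density_compactification = subtopology real_product (real_product closure_of range density_embedding)"

definition density_measure :: "(real \<Rightarrow> real) measure" where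
  "density_measure = distr gaussian (borel_of density_compactification) density_embedding"

lemma topspace_density_compactification:
  "topspace density_compactification = real_product closure_of range density_embedding"
  by (simp add: density_compactification_def)

lemma compact_space_density_compactification: "compact_space density_compactification"
proof -
  let ?C = "PiE UNIV (\<lambda>_::real. {0..1::real})"
  have "compactin real_product ?C"
    by (simp add: compactin_PiE)
  moreover have "real_product closure_of range density_embedding \<subseteq> ?C"
  proof (rule closure_of_minimal)
    show "range density_embedding \<subseteq> ?C"
      using bump_index_in by (fastforce simp: density_embedding_def bump_functions_def PiE_def)
    show "closedin real_product ?C"
      by (simp add: closedin_product_topology)
  qed
  ultimately have "compactin real_product (real_product closure_of range density_embedding)"
    by (rule closed_compactin) (rule closedin_closure_of)
  then show ?thesis
    unfolding density_compactification_def by (rule compact_space_subtopology)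
qed

lemma Hausdorff_space_density_compactification: "Hausdorff_space density_compactification"
  unfolding density_compactification_def
  by (intro Hausdorff_space_subtopology) (simp add: Hausdorff_space_product_topology)

lemma continuous_map_density_embedding:
  "continuous_map density_topology density_compactification density_embedding"
proof -
  have "continuous_map density_topology real_product density_embedding"
    using bump_index_in
    by (auto simp: continuous_map_componentwise_UNIV density_embedding_def bump_functions_def)
  moreover have "range density_embedding \<subseteq> real_product closure_of range density_embedding"
    by (rule closure_of_subset) simp
  ultimately show ?thesis
    by (auto simp: density_compactification_def continuous_map_in_subtopology)
qed

lemma density_embedding_in: "density_embedding x \<in> topspace density_compactification"
  using continuous_map_density_embedding by (auto simp: continuous_map_def)

lemma connected_space_density_compactification: "connected_space density_compactification"
proof -
  have "connectedin real_product (range density_embedding)"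
    using connected_space_density_topology continuous_map_density_embedding
      connectedin_continuous_map_image[of density_topology real_product density_embedding UNIV]
    by (auto simp: density_compactification_def continuous_map_in_subtopology connectedin_topspace[symmetric]
        simp flip: topspace_density_topology)
  then show ?thesis
    unfolding density_compactification_def
    by (simp add: connectedin_closure_of flip: connectedin_def) (meson connectedin_closure_of connectedin_def)
qed

text \<open>Reduces statements about open sets of the compactification to their traces on the
  line.\<close>

lemma density_embedding_dense:
  assumes "openin density_compactification U" "U \<noteq> {}"
  obtains x where "density_embedding x \<in> U"
proof -
  obtain S y where S: "openin real_product S" "U = S \<inter> real_product closure_of range density_embedding" "y \<in> U"
    using assms by (auto simp: density_compactification_def openin_subtopology)
  then obtain x where "density_embedding x \<in> S"
    by (auto simp: in_closure_of)
  then show thesis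
    using that[of x] S density_embedding_in[of x] by (auto simp: topspace_density_compactification)
qed

section \<open>Support, non-null closed sets and regularity of the image measure\<close>

lemma openin_vimage_density_embedding:
  assumes "openin density_compactification U"
  shows "openin density_topology (density_embedding -` U)"
  using openin_continuous_map_preimage[OF continuous_map_density_embedding assms]
  by (simp add: vimage_def)

lemma measurable_density_embedding:
  "density_embedding \<in> measurable gaussian (borel_of density_compactification)"
  unfolding borel_of_def
proof (rule measurable_measure_of)
  show "{U. openin density_compactification U} \<subseteq> Pow (topspace density_compactification)"
    using openin_subset by auto
  show "density_embedding \<in> space gaussian \<rightarrow> topspace density_compactification"
    using density_embedding_in by auto
  fix U assume "U \<in> {U. openin density_compactification U}"
  then show "density_embedding -` U \<inter> space gaussian \<in> sets gaussian"
    using openin_vimage_density_embedding[of U] by (simp add: openin_density_topology)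
qed

lemma sets_density_measure [simp]: "sets density_measure = sets (borel_of density_compactification)"
  by (simp add: density_measure_def)

lemma emeasure_density_measure:
  "A \<in> sets density_measure \<Longrightarrow> emeasure density_measure A = emeasure gaussian (density_embedding -` A)"
  by (simp add: density_measure_def emeasure_distr[OF measurable_density_embedding])

lemma measure_density_measure:
  "A \<in> sets density_measure \<Longrightarrow> measure density_measure A = measure gaussian (density_embedding -` A)"
  by (simp add: measure_def emeasure_density_measure)

lemma vimage_density_embedding_sets:
  "A \<in> sets density_measure \<Longrightarrow> density_embedding -` A \<in> sets lebesgue"
  using measurable_sets[OF measurable_density_embedding, of A] by simp

lemma prob_space_density_measure: "prob_space density_measure"
  unfolding density_measure_def
  using prob_space.prob_space_distr[OF prob_space_gaussian measurable_density_embedding] .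

lemma measure_gaussian_eq_0_iff:
  "A \<in> sets lebesgue \<Longrightarrow> measure gaussian A = 0 \<longleftrightarrow> A \<in> null_sets lebesgue"
proof -
  interpret prob_space gaussian by (rule prob_space_gaussian)
  assume "A \<in> sets lebesgue"
  then have "measure gaussian A = 0 \<longleftrightarrow> A \<in> null_sets gaussian"
    by (simp add: null_sets_def emeasure_eq_measure)
  then show ?thesis
    by (simp only: null_sets_gaussian)
qed

lemma is_support_of_density_measure: "is_support_of density_compactification density_measure"
  unfolding is_support_of_def
proof (intro allI impI, elim conjE)
  fix U assume U: "openin density_compactification U" "U \<noteq> {}"
  have "density_embedding -` U \<notin> null_sets lebesgue"
    using density_open_not_null[OF openin_vimage_density_embedding[OF U(1)]] density_embedding_dense[OF U]
    by blast
  moreover have *: "U \<in> sets density_measure"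
    using U by auto
  ultimately have "measure density_measure U \<noteq> 0"
    using measure_gaussian_eq_0_iff[OF vimage_density_embedding_sets[OF *]]
    by (simp only: measure_density_measure[OF *]) simp
  then show "0 < measure density_measure U"
    by (simp add: zero_less_measure_iff)
qed

lemma continuous_map_coordinate: "continuous_map density_compactification euclideanreal (\<lambda>y. y r)"
  unfolding density_compactification_def
  by (intro continuous_map_from_subtopology continuous_map_product_projection) simp

text \<open>A bump function vanishing off the preimage of \<open>F\<close> is itself a coordinate of
  the space. Where this coordinate is positive there is an open set, and its part outside
  \<open>F\<close> is open and misses the dense image of the line, so it is empty.\<close>

lemma interior_of_nonnull_closed:
  assumes F: "closedin density_compactification F" "0 < measure density_measure F"
  shows "density_compactification interior_of F \<noteq> {}"
proof -
  have FM: "F \<in> sets density_measure"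
    using F(1) by auto
  define G where "G = density_embedding -` F"
  have G: "G \<in> sets lebesgue"
    using vimage_density_embedding_sets[OF FM] by (simp add: G_def)
  have "G \<notin> null_sets lebesgue"
    using F(2) measure_gaussian_eq_0_iff[OF G] measure_density_measure[OF FM] by (simp add: G_def)
  then have "density_interior G \<noteq> {}"
    using density_interior(2)[OF G] by auto
  then obtain x where "x \<in> density_interior G"
    by blast
  then obtain f where f: "f \<in> bump_functions" "f x = 1" "\<And>y. y \<notin> G \<Longrightarrow> f y = 0"
    using bump_function_exists[OF G] by metis
  obtain r where r: "bump_index r = f"
    using bump_indexE[OF f(1)] .
  define V where "V = {y \<in> topspace density_compactification. y r \<in> {0<..}}"
  have V: "openin density_compactification V"
    unfolding V_def by (rule openin_continuous_map_preimage[OF continuous_map_coordinate]) simp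
  have "density_embedding x \<in> V"
    using density_embedding_in f(2) r by (simp add: V_def density_embedding_def)
  moreover have "V \<subseteq> F"
  proof (rule ccontr)
    assume "\<not> V \<subseteq> F"
    then obtain z where "density_embedding z \<in> V - F"
      using density_embedding_dense[of "V - F"] V F(1) by (metis Diff_eq_empty_iff openin_diff)
    then have "0 < f z" "z \<notin> G"
      using r by (auto simp: V_def G_def density_embedding_def)
    then show False
      using f(3) by force
  qed
  ultimately show ?thesis
    using V interior_of_maximal[of V F density_compactification] by blast
qed

text \<open>By regularity of the space, \<open>U\<close> is a union of open sets with closures
  inside \<open>U\<close>. Their preimages are density-open, so countably many of them already cover
  the preimage of \<open>U\<close> up to a null set. Finite unions of these open sets have measures
  tending to that of \<open>U\<close>, and the corresponding unions of closures lie between them and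
  \<open>U\<close>.\<close>

lemma regular_density_measure: "regular_measure density_compactification density_measure"
proof (rule regular_measureI)
  let ?L = density_compactification
  let ?e = density_embedding
  interpret prob_space density_measure by (rule prob_space_density_measure)
  show "finite_measure density_measure" by (rule finite_measure_axioms)
  show "closedin ?L C" if "compactin ?L C" for C
    using that compactin_imp_closedin Hausdorff_space_density_compactification by blast
  fix U and \<epsilon> :: real assume U: "openin ?L U" and \<epsilon>: "0 < \<epsilon>"
  have op: "V \<in> sets density_measure" if "openin ?L V" for V
    using that by auto
  have cl: "C \<in> sets density_measure" if "closedin ?L C" for C
    using that by auto
  define \<C> where "\<C> = {V. openin ?L V \<and> ?L closure_of V \<subseteq> U}"
  have "{} \<in> \<C>" by (simp add: \<C>_def)
  have cov: "\<exists>V\<in>\<C>. x \<in> V" if "x \<in> U" for x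
  proof -
    have "regular_space ?L"
      using compact_Hausdorff_imp_regular_space compact_space_density_compactification
        Hausdorff_space_density_compactification by blast
    moreover have "closedin ?L (topspace ?L - U)" "x \<in> topspace ?L - (topspace ?L - U)"
      using U that openin_subset by blast+
    ultimately obtain V W where VW: "openin ?L V" "openin ?L W" "x \<in> V" "topspace ?L - U \<subseteq> W" "disjnt V W"
      unfolding regular_space_def by metis
    have "?L closure_of V \<subseteq> topspace ?L - W"
      using VW openin_subset[OF VW(1)] by (intro closure_of_minimal) (auto simp: disjnt_def)
    with VW show ?thesis
      unfolding \<C>_def by blast
  qed
  obtain \<W> where \<W>: "countable \<W>" "\<W> \<subseteq> (vimage ?e) ` \<C>" "\<Union>((vimage ?e) ` \<C>) - \<Union>\<W> \<in> null_sets lebesgue"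
    by (rule density_open_family_countable[of "(vimage ?e) ` \<C>"])
      (use openin_vimage_density_embedding in \<open>auto simp: \<C>_def openin_density_topology\<close>)
  from \<W>(1,2) obtain \<V> where \<V>: "countable \<V>" "\<V> \<subseteq> \<C>" "\<W> = (vimage ?e) ` \<V>"
    using countable_subset_image[of \<W> "vimage ?e" \<C>] by blast
  \<comment> \<open>Inserting the empty set ensures that there is something to enumerate.\<close>
  define V where "V = from_nat_into (insert {} \<V>)"
  have range_V: "range V = insert {} \<V>"
    unfolding V_def using \<V>(1) by (intro range_from_nat_into) auto
  then have V: "V n \<in> \<C>" for n
    using \<open>{} \<in> \<C>\<close> \<V>(2) rangeI[of V n] unfolding range_V by auto
  define A where "A n = (\<Union>i\<le>n. V i)" for n
  define C where "C n = (\<Union>i\<le>n. ?L closure_of V i)" for n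
  have A: "openin ?L (A n)" for n
    using V by (auto simp: A_def \<C>_def)
  have C: "closedin ?L (C n)" for n
    by (auto simp: C_def intro!: closedin_Union)
  have AC: "A n \<subseteq> C n" for n
    unfolding A_def C_def
    by (intro UN_mono closure_of_subset openin_subset) (use V in \<open>auto simp: \<C>_def\<close>)
  have CU: "C n \<subseteq> U" for n
    unfolding C_def using V by (auto simp: \<C>_def)
  have UA: "(\<Union>n. A n) = \<Union>\<V>"
  proof -
    have "(\<Union>n. A n) = \<Union>(range V)"
      unfolding A_def by blast
    then show ?thesis by (simp add: range_V)
  qed
  have UAs: "openin ?L (\<Union>n. A n)"
    using A by auto
  have "?e -` (U - (\<Union>n. A n)) \<subseteq> \<Union>((vimage ?e) ` \<C>) - \<Union>\<W>"
    using cov unfolding UA \<V>(3) by auto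
  then have "?e -` (U - (\<Union>n. A n)) \<in> null_sets lebesgue"
    using \<W>(3) null_sets_completion_subset by blast
  moreover have d: "U - (\<Union>n. A n) \<in> sets density_measure"
    using op[OF U] op[OF UAs] by blast
  ultimately have "measure density_measure (U - (\<Union>n. A n)) = 0"
    using measure_gaussian_eq_0_iff[OF vimage_density_embedding_sets[OF d]] measure_density_measure[OF d] by simp
  moreover have "(\<Union>n. A n) \<subseteq> U"
    using AC CU by blast
  ultimately have eq: "measure density_measure U = measure density_measure (\<Union>n. A n)"
    using finite_measure_Diff[OF op[OF U] op[OF UAs]] by simp
  have "(\<lambda>n. measure density_measure (A n)) \<longlonglongrightarrow> measure density_measure (\<Union>n. A n)"
    using op[OF A] by (intro finite_Lim_measure_incseq) (force simp: incseq_def A_def)+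
  then obtain n where "\<bar>measure density_measure (A n) - measure density_measure (\<Union>n. A n)\<bar> < \<epsilon>"
    using \<epsilon> unfolding LIMSEQ_iff by (metis order_refl real_norm_def)
  then have "measure density_measure U - measure density_measure (A n) < \<epsilon>"
    using eq by linarith
  moreover have "measure density_measure (A n) \<le> measure density_measure (C n)"
    using AC cl[OF C] by (intro finite_measure_mono) auto
  moreover have "measure density_measure (U - C n) = measure density_measure U - measure density_measure (C n)"
    using CU by (intro finite_measure_Diff op U cl C)
  ultimately have "measure density_measure (U - C n) < \<epsilon>"
    by linarith
  then show "\<exists>C. closedin ?L C \<and> C \<subseteq> U \<and> measure density_measure (U - C) < \<epsilon>"
    using C CU by blast
qed (simp_all add: compact_space_density_compactification)

section \<open>Weight\<close>

lemma continuous_bump_function: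
  assumes "continuous_on UNIV f" "range f \<subseteq> {0..1}"
  shows "f \<in> bump_functions"
proof -
  have "open {x. f x < a}" "open {x. a < f x}" for a
    using assms(1) by (auto intro: open_Collect_less)
  then show ?thesis
    using assms(2) by (auto simp: bump_functions_def continuous_map_upper_lower_semicontinuous_lt
        intro: openin_density_topology_open)
qed

lemma bump_function_separating_nat:
  obtains f where "f \<in> bump_functions" "\<And>n. f (real (Suc n)) = (if n \<in> S then 1 else 0)"
proof -
  \<comment> \<open>The point 0 keeps \<open>A\<close> non-empty when \<open>S\<close> is empty; the
    shift by \<open>Suc\<close> keeps it at distance at least 1 from all points where
    \<open>f\<close> is tested.\<close>
  define A where "A = real ` insert 0 (Suc ` S)"
  define f where "f x = max 0 (1 - infdist x A)" for x
  have "A \<noteq> {}"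
    by (auto simp: A_def)
  have "continuous_on UNIV f"
    unfolding f_def by (intro continuous_intros)
  moreover have "range f \<subseteq> {0..1}"
    using infdist_nonneg by (auto simp: f_def)
  ultimately have "f \<in> bump_functions"
    by (rule continuous_bump_function)
  moreover have "f (real (Suc n)) = (if n \<in> S then 1 else 0)" for n
  proof (cases "n \<in> S")
    case True
    then have "real (Suc n) \<in> A"
      unfolding A_def by (intro imageI insertI2)
    with True show ?thesis by (simp add: f_def)
  next
    case False
    have "1 \<le> infdist (real (Suc n)) A"
      unfolding infdist_notempty[OF \<open>A \<noteq> {}\<close>]
    proof (rule cINF_greatest[OF \<open>A \<noteq> {}\<close>])
      fix a assume "a \<in> A"
      then obtain k where k: "a = real k" "k \<noteq> Suc n"
        using False by (auto simp: A_def)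
      show "1 \<le> dist (real (Suc n)) a"
        unfolding k(1) dist_of_nat using k(2) by linarith
    qed
    with False show ?thesis by (simp add: f_def)
  qed
  ultimately show thesis using that by blast
qed

text \<open>Each set \<open>S\<close> of naturals gives a compact set where a coordinate is at least
  1 inside an open set where it is positive. Finitely many members of the base fit between the two,
  and they determine \<open>S\<close>. So there are at least continuum many finite subfamilies, and
  an infinite base has only as many finite subfamilies as members.\<close>

lemma reals_lepoll_base:
  assumes "topology_base density_compactification \<B>"
  shows "(UNIV :: real set) \<lesssim> \<B>"
proof -
  let ?L = density_compactification
  have base: "openin ?L V" if "V \<in> \<B>" for V
    using assms that by (simp add: topology_base_def)
  have base_ex: "\<exists>V\<in>\<B>. x \<in> V \<and> V \<subseteq> U" if "openin ?L U" "x \<in> U" for U x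
    using assms that by (auto simp: topology_base_def)
  have "\<exists>r. \<forall>n. bump_index r (real (Suc n)) = (if n \<in> S then 1 else 0)" for S
    using bump_function_separating_nat[of S] bump_indexE by metis
  then obtain r where r: "\<And>S n. bump_index (r S) (real (Suc n)) = (if n \<in> S then 1 else 0)"
    by metis
  have "\<forall>S. \<exists>\<F>. \<F> \<in> Fpow \<B> \<and> {y \<in> topspace ?L. 1 \<le> y (r S)} \<subseteq> \<Union>\<F> \<and> \<Union>\<F> \<subseteq> {y. 0 < y (r S)}"
  proof
    fix S
    define K where "K = {y \<in> topspace ?L. y (r S) \<in> {1..}}"
    define U where "U = {y \<in> topspace ?L. y (r S) \<in> {0<..}}"
    have "closedin ?L K"
      unfolding K_def by (rule closedin_continuous_map_preimage[OF continuous_map_coordinate]) simp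
    then have "compactin ?L K"
      using compact_space_density_compactification closedin_compact_space by blast
    moreover have U: "openin ?L U"
      unfolding U_def by (rule openin_continuous_map_preimage[OF continuous_map_coordinate]) simp
    have "K \<subseteq> \<Union>{V \<in> \<B>. V \<subseteq> U}"
    proof
      fix y assume "y \<in> K"
      then have "y \<in> U" by (auto simp: K_def U_def)
      then show "y \<in> \<Union>{V \<in> \<B>. V \<subseteq> U}"
        using base_ex[OF U] by blast
    qed
    ultimately obtain \<F> where "finite \<F>" "\<F> \<subseteq> {V \<in> \<B>. V \<subseteq> U}" "K \<subseteq> \<Union>\<F>"
      using base compactinD[of ?L K "{V \<in> \<B>. V \<subseteq> U}"] by blast
    then show "\<exists>\<F>. \<F> \<in> Fpow \<B> \<and> {y \<in> topspace ?L. 1 \<le> y (r S)} \<subseteq> \<Union>\<F> \<and> \<Union>\<F> \<subseteq> {y. 0 < y (r S)}"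
      by (intro exI[of _ \<F>]) (auto simp: Fpow_def K_def U_def)
  qed
  then obtain \<Phi> where "\<forall>S. \<Phi> S \<in> Fpow \<B> \<and> {y \<in> topspace ?L. 1 \<le> y (r S)} \<subseteq> \<Union>(\<Phi> S) \<and> \<Union>(\<Phi> S) \<subseteq> {y. 0 < y (r S)}"
    by (rule choice[THEN exE])
  then have \<Phi>: "\<Phi> S \<in> Fpow \<B>" "{y \<in> topspace ?L. 1 \<le> y (r S)} \<subseteq> \<Union>(\<Phi> S)"
    "\<Union>(\<Phi> S) \<subseteq> {y. 0 < y (r S)}" for S
    by simp_all
  \<comment> \<open>For \<open>n \<in> S\<close> the image of \<open>Suc n\<close> lies in the
    compact set for \<open>S\<close>, hence in the common union, hence in the open set for
    \<open>S'\<close>; its coordinate takes only the values 0 and 1, so positivity means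
    \<open>n \<in> S'\<close>.\<close>
  have sub: "S \<subseteq> S'" if "\<Phi> S = \<Phi> S'" for S S'
  proof
    fix n assume "n \<in> S"
    then have "density_embedding (real (Suc n)) \<in> {y \<in> topspace ?L. 1 \<le> y (r S)}"
      using density_embedding_in r[of S n] by (simp add: density_embedding_def)
    then have "density_embedding (real (Suc n)) \<in> {y. 0 < y (r S')}"
      using \<Phi>(2)[of S] \<Phi>(3)[of S'] that by auto
    then show "n \<in> S'"
      using r[of S' n] by (auto simp: density_embedding_def split: if_splits)
  qed
  have "inj \<Phi>"
  proof (rule injI)
    fix S S' assume "\<Phi> S = \<Phi> S'"
    then show "S = S'"
      using sub[of S S'] sub[of S' S] by simp
  qed
  then have *: "(UNIV :: nat set set) \<lesssim> Fpow \<B>"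
    using \<Phi>(1) by (auto simp: lepoll_def)
  have "infinite \<B>"
  proof
    assume "finite \<B>"
    then have "finite (Fpow \<B>)"
      by (simp add: Fpow_Pow_finite)
    then have "finite (UNIV :: nat set set)"
      using * lepoll_def by (meson finite_lepoll_infinite finite_subset inj_on_finite)
    then show False
      by (simp add: Finite_Set.finite_set)
  qed
  have "(UNIV :: real set) \<approx> (UNIV :: nat set set)"
    using nat_sets_eqpoll_reals eqpoll_sym by blast
  also note *
  also have "Fpow \<B> \<lesssim> \<B>"
    using \<open>infinite \<B>\<close> by (rule infinite_Fpow_lepoll)
  finally show ?thesis .
qed

text \<open>The traces of basic boxes form a base. A box is described by finitely many triples of a
  coordinate and two real bounds, and there are continuum many finite sets of such triples.\<close>

lemma base_lepoll_reals:
  obtains \<B> where "topology_base density_compactification \<B>" "\<B> \<lesssim> (UNIV :: real set)"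
proof -
  let ?L = density_compactification
  define box where "box J = {y \<in> topspace ?L. \<forall>(r, p, q)\<in>J. p < y r \<and> y r < q}" for J :: "(real \<times> real \<times> real) set"
  define \<B> where "\<B> = box ` Fpow UNIV"
  have "openin ?L (box J)" if "finite J" for J
    using that
  proof (induction J)
    case empty
    then show ?case by (simp add: box_def)
  next
    case (insert j J)
    obtain r p q where j: "j = (r, p, q)"
      by (cases j) auto
    have "openin ?L {y \<in> topspace ?L. y r \<in> {p<..<q}}"
      by (rule openin_continuous_map_preimage[OF continuous_map_coordinate]) simp
    moreover have "box (insert j J) = {y \<in> topspace ?L. y r \<in> {p<..<q}} \<inter> box J"
      by (auto simp: box_def j)
    ultimately show ?case
      using insert.IH by auto
  qed
  then have op: "openin ?L V" if "V \<in> \<B>" for V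
    using that by (auto simp: \<B>_def Fpow_def)
  have nb: "\<exists>V\<in>\<B>. x \<in> V \<and> V \<subseteq> U" if U: "openin ?L U" "x \<in> U" for U x
  proof -
    obtain S where S: "openin real_product S" "U = S \<inter> topspace ?L"
      using U(1) by (auto simp: density_compactification_def openin_subtopology)
    then obtain Q where Q: "finite {i. Q i \<noteq> UNIV}" "\<And>i. open (Q i)" "x \<in> PiE UNIV Q" "PiE UNIV Q \<subseteq> S"
      using U(2) by (auto simp: openin_product_topology_alt)
    have "\<exists>p q. p < x i \<and> x i < q \<and> {p<..<q} \<subseteq> Q i" for i
    proof -
      have "x i \<in> Q i" using Q(3) by auto
      then obtain e where "0 < e" "ball (x i) e \<subseteq> Q i"
        using Q(2) openE by blast
      then show ?thesis
        by (intro exI[of _ "x i - e"] exI[of _ "x i + e"]) (auto simp: ball_eq_greaterThanLessThan)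
    qed
    then obtain p q where pq: "\<And>i. p i < x i \<and> x i < q i \<and> {p i<..<q i} \<subseteq> Q i"
      by metis
    define J where "J = (\<lambda>i. (i, p i, q i)) ` {i. Q i \<noteq> UNIV}"
    have "x \<in> box J"
      using U openin_subset[OF U(1)] pq by (auto simp: box_def J_def)
    moreover have "box J \<subseteq> U"
    proof
      fix y assume y: "y \<in> box J"
      have "y i \<in> Q i" for i
      proof (cases "Q i = UNIV")
        case False
        then have "(i, p i, q i) \<in> J" by (simp add: J_def)
        then have "y i \<in> {p i<..<q i}"
          using y by (auto simp: box_def)
        then show ?thesis using pq by blast
      qed simp
      then have "y \<in> S"
        using Q(4) by (auto simp: PiE_def)
      then show "y \<in> U"
        using y S(2) by (simp add: box_def)
    qed
    moreover have "J \<in> Fpow UNIV"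
      using Q(1) by (simp add: J_def Fpow_def)
    ultimately show ?thesis
      unfolding \<B>_def by blast
  qed
  have inf: "infinite (UNIV :: real set)"
    by (rule infinite_UNIV_char_0)
  have RR: "(UNIV :: real set) \<times> (UNIV :: real set) \<approx> (UNIV :: real set)"
    using infinite_Times_self_eqpoll[OF inf] .
  have inf3: "infinite (UNIV :: (real \<times> real \<times> real) set)"
    by (simp add: finite_prod inf)
  have "\<B> \<lesssim> Fpow (UNIV :: (real \<times> real \<times> real) set)"
    unfolding \<B>_def by (rule image_lepoll)
  also have "\<dots> \<lesssim> (UNIV :: (real \<times> real \<times> real) set)"
    by (rule infinite_Fpow_lepoll[OF inf3])
  also have "(UNIV :: (real \<times> real \<times> real) set) \<approx> (UNIV :: real set) \<times> (UNIV :: real set)"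
    unfolding UNIV_Times_UNIV[symmetric] using RR by (intro times_eqpoll_cong) auto
  also note RR
  finally have "\<B> \<lesssim> (UNIV :: real set)" .
  then show thesis
    using that[of \<B>] op nb by (auto simp: topology_base_def)
qed

lemma has_weight_density_compactification: "has_weight density_compactification (UNIV :: real set)"
proof -
  obtain \<B> where \<B>: "topology_base density_compactification \<B>" "\<B> \<lesssim> (UNIV :: real set)"
    by (rule base_lepoll_reals)
  then have "\<B> \<approx> (UNIV :: real set)"
    using reals_lepoll_base lepoll_antisym by blast
  then show ?thesis
    unfolding has_weight_def using \<B>(1) reals_lepoll_base by blast
qed

theorem theorem1p2:
  "\<exists>(L :: (real \<Rightarrow> real) topology) \<mu>.
     compact_space L \<and> Hausdorff_space L \<and> connected_space L \<and>
     has_weight L (UNIV :: real set) \<and>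
     \<mu> \<in> regular_borel_probs L \<and> normal_measure L \<mu> \<and> is_support_of L \<mu>"
proof (intro exI conjI)
  show "density_measure \<in> regular_borel_probs density_compactification"
    by (simp add: regular_borel_probs_def prob_space_density_measure regular_density_measure)
  show "normal_measure density_compactification density_measure"
    by (intro normal_measureI compact_space_density_compactification Hausdorff_space_density_compactification
        sets_density_measure prob_space_density_measure is_support_of_density_measure interior_of_nonnull_closed)
qed (fact compact_space_density_compactification Hausdorff_space_density_compactification
    connected_space_density_compactification has_weight_density_compactification is_support_of_density_measure)+

end
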